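(* Let $X\subseteq\mathbb{R}^m$ ($m>1$) be bounded and open, $Y=(0,\bar y)$ with $\bar y>0$, let $c\in C^2(\overline X\times\overline Y)$ be twisted and non-degenerate, and let $\mu$ be a probability measure on $X$ absolutely continuous with respect to Lebesgue measure. Let $f:[0,\infty)\to\mathbb{R}$ be continuously differentiable on $(0,\infty)$ and strictly convex with superlinear growth at infinity and $\lim_{s\to0^+}f'(s)=-\infty$. Suppose that $\nu$ minimizes $$\nu\mapsto\mathcal T_c(\mu,\nu)+\int_Yf(\bar\nu(y))\,dy$$ over $P(\overline Y)$. Then $(c,\mu,\nu)$ is nested provided that, for all $y_0\in Y$, $$\sup_{y_1\in Y,\ y_1>y_0,\ y_0\le y\le y_1}\left[\frac{D^{min}_\mu(y_0,y_1,k(y_0))}{y_1-y_0}-(f')^{-1}\big(K_{-M_c|\cdot|}(1)-M_cy\big)\right]<0 .$$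
   Context: $P(\overline Y)$ is the set of Borel probability measures on $\overline Y$. $\mathcal T_c(\mu,\nu)=\inf_{\gamma\in\Pi(\mu,\nu)}\int c\,d\gamma$, with $\Pi(\mu,\nu)$ the couplings of $\mu$ and $\nu$. The term $\int_Yf(\bar\nu)\,dy$ is $+\infty$ if $\nu$ is not absolutely continuous; otherwise $\bar\nu$ is the density of $\nu$. Twisted: for each $x\in X$ the map $y\mapsto D_xc(x,y)$ is injective on $Y$. Non-degenerate: $D^2_{xy}c(x,y)\neq 0$ for all $(x,y)\in\overline X\times\overline Y$. $M_c=\sup_{x\in\overline X,\ y_0\ne y_1\in\overline Y}\frac{|c(x,y_0)-c(x,y_1)|}{|y_0-y_1|}$. For a bounded function $v:Y\to\mathbb{R}$, $K_v:(0,\infty)\to\mathbb{R}$ is the inverse of the increasing function $z\mapsto\int_Y(f')^{-1}(z-v(y))\,dy$ from $\mathbb{R}$ onto $(0,\infty)$; $K_{-M_c|\cdot|}$ is $K_v$ with $v(y)=-M_c|y|$. For $y\in Y$ and $k\in\mathbb{R}$: $X_=(y,k)=\{x\in X:\frac{\partial c}{\partial y}(x,y)=k\}$, $X_\ge(y,k)=\{x\in X:\frac{\partial c}{\partial y}(x,y)\ge k\}$, $X_>(y,k)=X_\ge(y,k)\setminus X_=(y,k)$. The mass-splitting level $k(y)$, $y\in Y$, is defined by $\mu(X_\ge(y,k(y)))=\nu((-\infty,y])$ (if this does not determine $k(y)$ uniquely, $k$ denotes a fixed choice). The model $(c,\mu,\nu)$ is nested if for all $y_0<y_1$ in $Y$: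 $\nu([y_0,y_1])>0$ implies $X_\ge(y_0,k(y_0))\subseteq X_>(y_1,k(y_1))$. For $y_0<y_1$ in $Y$: $k_{max}(y_0,y_1,k_0)=\sup\{k: X_\ge(y_0,k_0)\subseteq X_\ge(y_1,k)\}$ and $D^{min}_\mu(y_0,y_1,k_0)=\mu\big(X_\ge(y_1,k_{max}(y_0,y_1,k_0))\setminus X_\ge(y_0,k_0)\big)$ (if $X_\ge(y_0,k_0)=\emptyset$ then $k_{max}=+\infty$ and this quantity is $0$). *)

theory Defs
  imports "HOL-Probability.Probability"
begin

text \<open>
  Functions that mathematically live on a subset (such as \<open>c\<close> on
  \<open>closure X \<times> closure Y\<close>, or \<open>f\<close> on \<open>[0,\<infinity>)\<close>) are total HOL functions here; nothing below
  depends on their values off that subset.  Likewise Borel measures on a set \<open>S\<close> are Borel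
  measures on the whole space that are concentrated on \<open>S\<close>.
\<close>

subsection \<open>Regularity of the cost\<close>

text \<open>
  \<open>C\<^sup>2\<close> up to the boundary: twice continuously differentiable on the open set \<open>U\<close>, and all
  derivatives of order at most two extend continuously to \<open>closure U\<close>.
\<close>

definition C2_closure :: "'a::euclidean_space set \<Rightarrow> ('a \<Rightarrow> real) \<Rightarrow> bool" where
  "C2_closure U g \<longleftrightarrow>
    (\<exists>(g' :: 'a \<Rightarrow> 'a \<Rightarrow>\<^sub>L real) (g'' :: 'a \<Rightarrow> 'a \<Rightarrow>\<^sub>L 'a \<Rightarrow>\<^sub>L real).
      continuous_on (closure U) g \<and> continuous_on (closure U) g' \<and> continuous_on (closure U) g'' \<and>
      (\<forall>p\<in>U. (g has_derivative blinfun_apply (g' p)) (at p)) \<and>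
      (\<forall>p\<in>U. (g' has_derivative blinfun_apply (g'' p)) (at p)))"

definition grad_x :: "(real ^ 'm \<Rightarrow> real \<Rightarrow> real) \<Rightarrow> real ^ 'm \<Rightarrow> real \<Rightarrow> real ^ 'm" where
  "grad_x c x y = (\<chi> i. frechet_derivative (\<lambda>s. c s y) (at x) (axis i 1))"

definition twisted :: "(real ^ 'm) set \<Rightarrow> real set \<Rightarrow> (real ^ 'm \<Rightarrow> real \<Rightarrow> real) \<Rightarrow> bool" where
  "twisted X Y c \<longleftrightarrow> (\<forall>x\<in>X. inj_on (\<lambda>y. grad_x c x y) Y)"

text \<open>
  The mixed derivative on \<open>closure X \<times> closure Y\<close> is the continuous extension of the one on the
  open set \<open>X \<times> Y\<close>; at points of \<open>X \<times> Y\<close> the limit is the derivative itself when \<open>c\<close> is \<open>C\<^sup>2\<close>.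
\<close>

definition D2_xy ::
  "(real ^ 'm) set \<Rightarrow> real set \<Rightarrow> (real ^ 'm \<Rightarrow> real \<Rightarrow> real) \<Rightarrow> real ^ 'm \<Rightarrow> real \<Rightarrow> real ^ 'm" where
  "D2_xy X Y c x y =
    Lim (at (x, y) within X \<times> Y) (\<lambda>(s, t). vector_derivative (\<lambda>r. grad_x c s r) (at t))"

definition nondegenerate :: "(real ^ 'm) set \<Rightarrow> real set \<Rightarrow> (real ^ 'm \<Rightarrow> real \<Rightarrow> real) \<Rightarrow> bool" where
  "nondegenerate X Y c \<longleftrightarrow> (\<forall>x\<in>closure X. \<forall>y\<in>closure Y. D2_xy X Y c x y \<noteq> 0)"

text \<open>The supremum is finite for \<open>c\<close> of class \<open>C\<^sup>2\<close> up to the boundary, \<open>X\<close> and \<open>Y\<close> bounded, \<open>Y\<close> an interval.\<close>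

definition M_c :: "'a::topological_space set \<Rightarrow> real set \<Rightarrow> ('a \<Rightarrow> real \<Rightarrow> real) \<Rightarrow> real" where
  "M_c X Y c =
    (SUP (x, y0, y1) \<in> {(x, y0, y1). x \<in> closure X \<and> y0 \<in> closure Y \<and> y1 \<in> closure Y \<and> y0 \<noteq> y1}.
       \<bar>c x y0 - c x y1\<bar> / \<bar>y0 - y1\<bar>)"


subsection \<open>The variational problem\<close>

definition borel_probs :: "'a::topological_space set \<Rightarrow> 'a measure set" where
  "borel_probs S = {M. prob_space M \<and> sets M = sets borel \<and> emeasure M S = 1}"

definition couplings ::
  "'a::topological_space measure \<Rightarrow> 'b::topological_space measure \<Rightarrow> ('a \<times> 'b) measure set" where
  "couplings \<mu> \<nu> = {\<gamma>. sets \<gamma> = sets borel \<and> distr \<gamma> borel fst = \<mu> \<and> distr \<gamma> borel snd = \<nu>}"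

text \<open>
  All couplings are concentrated on \<open>closure X \<times> closure Y\<close>; the integral is restricted to it since
  \<open>c\<close> is unconstrained (possibly not even measurable) elsewhere.
\<close>

definition transport_cost ::
  "'a::topological_space set \<Rightarrow> real set \<Rightarrow> ('a \<Rightarrow> real \<Rightarrow> real) \<Rightarrow> 'a measure \<Rightarrow> real measure \<Rightarrow> ereal" where
  "transport_cost X Y c \<mu> \<nu> =
    (INF \<gamma> \<in> couplings \<mu> \<nu>. ereal (LINT p:closure X \<times> closure Y|\<gamma>. c (fst p) (snd p)))"

text \<open>
  The integral of \<open>f\<close> composed with the density is the extended Lebesgue integral, positive minus
  negative part.  On a bounded set \<open>Y\<close> the negative part is finite when \<open>f\<close> is bounded below,
  while the positive part may be infinite.
\<close>

definition internal_energy :: "real set \<Rightarrow> (real \<Rightarrow> real) \<Rightarrow> real measure \<Rightarrow> ereal" where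
  "internal_energy Y f \<nu> =
    (if absolutely_continuous lborel \<nu>
     then enn2ereal (\<integral>\<^sup>+y\<in>Y. ennreal (f (enn2real (RN_deriv lborel \<nu> y))) \<partial>lborel)
        - enn2ereal (\<integral>\<^sup>+y\<in>Y. ennreal (- f (enn2real (RN_deriv lborel \<nu> y))) \<partial>lborel)
     else \<infinity>)"

definition is_minimizer ::
  "'a::topological_space set \<Rightarrow> real set \<Rightarrow> ('a \<Rightarrow> real \<Rightarrow> real) \<Rightarrow> (real \<Rightarrow> real) \<Rightarrow>
    'a measure \<Rightarrow> real measure \<Rightarrow> bool" where
  "is_minimizer X Y c f \<mu> \<nu> \<longleftrightarrow>
    \<nu> \<in> borel_probs (closure Y) \<and>
    (\<forall>\<nu>' \<in> borel_probs (closure Y).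
       transport_cost X Y c \<mu> \<nu> + internal_energy Y f \<nu>
         \<le> transport_cost X Y c \<mu> \<nu>' + internal_energy Y f \<nu>')"


subsection \<open>The congestion function\<close>

definition strictly_convex_on :: "'a::real_vector set \<Rightarrow> ('a \<Rightarrow> real) \<Rightarrow> bool" where
  "strictly_convex_on S f \<longleftrightarrow>
    convex S \<and>
    (\<forall>x\<in>S. \<forall>y\<in>S. \<forall>u v. x \<noteq> y \<and> 0 < u \<and> 0 < v \<and> u + v = 1 \<longrightarrow>
       f (u *\<^sub>R x + v *\<^sub>R y) < u * f x + v * f y)"

definition deriv_inv :: "(real \<Rightarrow> real) \<Rightarrow> real \<Rightarrow> real" where
  "deriv_inv f = inv_into {0<..} (deriv f)"

definition K_inv :: "real set \<Rightarrow> (real \<Rightarrow> real) \<Rightarrow> (real \<Rightarrow> real) \<Rightarrow> real \<Rightarrow> real" where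
  "K_inv Y f v = inv (\<lambda>z. LINT y:Y|lborel. deriv_inv f (z - v y))"


subsection \<open>Nestedness\<close>

definition X_eq :: "'a set \<Rightarrow> ('a \<Rightarrow> real \<Rightarrow> real) \<Rightarrow> real \<Rightarrow> real \<Rightarrow> 'a set" where
  "X_eq X c y k = {x \<in> X. deriv (c x) y = k}"

definition X_ge :: "'a set \<Rightarrow> ('a \<Rightarrow> real \<Rightarrow> real) \<Rightarrow> real \<Rightarrow> real \<Rightarrow> 'a set" where
  "X_ge X c y k = {x \<in> X. deriv (c x) y \<ge> k}"

definition X_gt :: "'a set \<Rightarrow> ('a \<Rightarrow> real \<Rightarrow> real) \<Rightarrow> real \<Rightarrow> real \<Rightarrow> 'a set" where
  "X_gt X c y k = X_ge X c y k - X_eq X c y k"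

text \<open>\<open>k\<close> need not be unique, so being a mass-splitting level is a predicate on \<open>k\<close>.\<close>

definition mass_splitting_level ::
  "'a set \<Rightarrow> real set \<Rightarrow> ('a \<Rightarrow> real \<Rightarrow> real) \<Rightarrow> 'a measure \<Rightarrow> real measure \<Rightarrow> (real \<Rightarrow> real) \<Rightarrow> bool" where
  "mass_splitting_level X Y c \<mu> \<nu> k \<longleftrightarrow>
    (\<forall>y\<in>Y. measure \<mu> (X_ge X c y (k y)) = measure \<nu> {..y})"

text \<open>Nestedness of \<open>(c, \<mu>, \<nu>)\<close>; the measure \<open>\<mu>\<close> enters through the mass-splitting level \<open>k\<close>.\<close>

definition nested ::
  "'a set \<Rightarrow> real set \<Rightarrow> ('a \<Rightarrow> real \<Rightarrow> real) \<Rightarrow> real measure \<Rightarrow> (real \<Rightarrow> real) \<Rightarrow> bool" where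
  "nested X Y c \<nu> k \<longleftrightarrow>
    (\<forall>y0\<in>Y. \<forall>y1\<in>Y. y0 < y1 \<longrightarrow> measure \<nu> {y0..y1} > 0 \<longrightarrow>
       X_ge X c y0 (k y0) \<subseteq> X_gt X c y1 (k y1))"

definition k_max :: "'a set \<Rightarrow> ('a \<Rightarrow> real \<Rightarrow> real) \<Rightarrow> real \<Rightarrow> real \<Rightarrow> real \<Rightarrow> ereal" where
  "k_max X c y0 y1 k0 = (SUP k \<in> {k. X_ge X c y0 k0 \<subseteq> X_ge X c y1 k}. ereal k)"

text \<open>
  If \<open>X_ge X c y0 k0\<close> is empty then \<open>k_max = \<infinity>\<close>, and the difference is empty.  Otherwise
  \<open>k_max < \<infinity>\<close>, and \<open>k_max > -\<infinity>\<close> as soon as \<open>x \<mapsto> deriv (c x) y1\<close> is bounded below on \<open>X\<close>.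
\<close>

definition D_min ::
  "'a set \<Rightarrow> ('a \<Rightarrow> real \<Rightarrow> real) \<Rightarrow> 'a measure \<Rightarrow> real \<Rightarrow> real \<Rightarrow> real \<Rightarrow> real" where
  "D_min X c \<mu> y0 y1 k0 =
    (if X_ge X c y0 k0 = {} then 0
     else measure \<mu> (X_ge X c y1 (real_of_ereal (k_max X c y0 y1 k0)) - X_ge X c y0 k0))"

end

theory Submission
  imports Defs
begin

text \<open>
  Let \<open>g\<close> be the density of the minimizer.  Moving a little mass of \<open>\<nu>\<close> by \<open>t\<close> raises the
  transport cost by at most \<open>M_c \<bar>t\<bar>\<close> per unit of mass, so minimality gives
  \<open>f' (g y) \<le> f' (g (y + t)) + M_c \<bar>t\<bar>\<close> almost everywhere; in other words \<open>f' \<circ> g\<close> is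
  \<open>M_c\<close>-Lipschitz, and no Kantorovich potential is needed.  Since \<open>\<bar>y - z\<bar> \<le> y + z\<close>, this bounds
  \<open>g\<close> above by \<open>y \<mapsto> (f')\<inverse> (f' (g z) + M_c z + M_c y)\<close> for almost every \<open>z\<close>, and
  \<open>\<integral> g = 1\<close> then forces \<open>K 1 \<le> f' (g z) + M_c z\<close>, where \<open>K\<close> is \<open>K_inv\<close> for the function
  \<open>- M_c \<bar>y\<bar>\<close>.  Hence \<open>g z \<ge> (f')\<inverse> (K 1 - M_c z)\<close>, so that the hypothesis makes the minimal mass
  difference strictly smaller than the \<open>\<nu>\<close>-mass of \<open>(y0, y1]\<close>, that is \<open>k y1 < k_max\<close>.
\<close>

subsection \<open>The derivative of the congestion function\<close>

locale congestion =
  fixes f :: "real \<Rightarrow> real"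
  assumes differentiable: "f differentiable_on {0<..}"
    and continuous_deriv: "continuous_on {0<..} (deriv f)"
    and strictly_convex: "strictly_convex_on {0..} f"
    and superlinear: "filterlim (\<lambda>s. f s / s) at_top at_top"
    and deriv_at_0: "filterlim (deriv f) at_bot (at_right 0)"
begin

lemma has_real_derivative:
  assumes "b > 0"
  shows "(f has_real_derivative deriv f b) (at b)"
  using differentiable assms
  by (simp add: differentiable_on_eq_differentiable_at)
     (use DERIV_deriv_iff_real_differentiable in blast)

lemma convex: "convex_on {0..} f"
  unfolding convex_on_def
proof (intro conjI ballI allI impI)
  fix x y u v :: real
  assume *: "x \<in> {0..}" "y \<in> {0..}" "0 \<le> u" "0 \<le> v" "u + v = 1"
  have one: "u * z + v * z = z" for z
    using *(5) by (simp only: distrib_right[symmetric] mult_1)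
  consider "x = y" | "u = 0" | "v = 0" | "x \<noteq> y" "0 < u" "0 < v"
    using * by linarith
  then show "f (u *\<^sub>R x + v *\<^sub>R y) \<le> u * f x + v * f y"
  proof cases
    case 4
    with strictly_convex * show ?thesis
      unfolding strictly_convex_on_def by (intro less_imp_le) blast
  qed (use * one in simp_all)
qed simp

text \<open>Convexity puts the graph above the tangent at \<open>b\<close>. The point
  \<open>a\<close> may be \<open>0\<close>, because the inequality is applied where the density
  vanishes.\<close>

lemma tangent:
  assumes "a \<ge> 0" "b > 0"
  shows "f b - f a \<le> deriv f b * (b - a)"
proof -
  have "f a - f b \<ge> deriv f b * (a - b)"
    using assms
    by (intro convex_on_imp_above_tangent[OF convex
          _ _ _ has_field_derivative_at_within[OF has_real_derivative]]) auto
  then show ?thesis by (simp add: algebra_simps)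
qed

text \<open>The two tangent inequalities together give weak monotonicity. Equal slopes would make
  \<open>f\<close> affine between \<open>a\<close> and \<open>b\<close>, which strict convexity at
  the midpoint excludes.\<close>

lemma deriv_strict_mono:
  assumes "0 < a" "a < b"
  shows "deriv f a < deriv f b"
proof -
  have 1: "f b - f a \<le> deriv f b * (b - a)" and 2: "f a - f b \<le> deriv f a * (a - b)"
    using assms tangent[of a b] tangent[of b a] by auto
  have "deriv f a * (b - a) \<le> deriv f b * (b - a)"
    using 1 2 by (simp add: algebra_simps)
  then have le: "deriv f a \<le> deriv f b" using assms by simp
  have "deriv f a \<noteq> deriv f b"
  proof
    assume eq: "deriv f a = deriv f b"
    let ?m = "(a + b) / 2"
    have "f ?m < f a / 2 + f b / 2"
      using strictly_convex assms unfolding strictly_convex_on_def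
      by (elim conjE) (drule bspec[of _ _ a], simp, drule bspec[of _ _ b], simp,
          drule spec[of _ "1/2"], drule spec[of _ "1/2"], simp add: add_divide_distrib)
    moreover have "f a - f ?m \<le> deriv f a * (a - ?m)"
      using tangent[of ?m a] assms by auto
    ultimately show False
      using 1 2 eq by (simp add: field_simps)
  qed
  with le show ?thesis by simp
qed

lemma deriv_less_iff:
  assumes "0 < a" "0 < b"
  shows "deriv f a < deriv f b \<longleftrightarrow> a < b"
  using deriv_strict_mono[of a b] deriv_strict_mono[of b a] assms
  by (cases a b rule: linorder_cases) auto

lemma inj_on_deriv: "inj_on (deriv f) {0<..}"
proof (rule inj_onI)
  fix a b :: real
  assume "a \<in> {0<..}" "b \<in> {0<..}" "deriv f a = deriv f b"
  then show "a = b" using deriv_less_iff[of a b] deriv_less_iff[of b a] by simp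
qed

text \<open>Intermediate value theorem: the limit at \<open>0\<close> supplies a point of slope at
  most \<open>z\<close>, superlinear growth one of slope at least \<open>z\<close>.\<close>

lemma deriv_surj: "\<exists>a>0. deriv f a = z"
proof -
  have "\<forall>\<^sub>F a in at_right 0. deriv f a \<le> z"
    using deriv_at_0 by (simp add: filterlim_at_bot)
  then obtain b where b: "b > 0" "\<And>a. 0 < a \<Longrightarrow> a < b \<Longrightarrow> deriv f a \<le> z"
    unfolding eventually_at_right_field by auto
  define l where "l = b / 2"
  have l: "l > 0" "deriv f l \<le> z" using b by (auto simp: l_def)
  have "\<exists>h>1. deriv f h \<ge> z"
  proof (rule ccontr)
    assume "\<not> ?thesis"
    then have z: "deriv f s \<le> z" if "s > 1" for s using that by force
    \<comment> \<open>The constant exceeds by one the bound on \<open>f s / s\<close> that slopes at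
      most \<open>z\<close> beyond \<open>1\<close> would give.\<close>
    have "\<forall>\<^sub>F s in at_top. f s / s \<ge> \<bar>f 1\<bar> + \<bar>z\<bar> + 1"
      using superlinear by (simp add: filterlim_at_top)
    then have "\<forall>\<^sub>F s in at_top. f s / s \<ge> \<bar>f 1\<bar> + \<bar>z\<bar> + 1 \<and> s > (1::real)"
      using eventually_gt_at_top by (rule eventually_conj)
    then obtain s where s: "f s / s \<ge> \<bar>f 1\<bar> + \<bar>z\<bar> + 1" "s > (1::real)"
      using eventually_happens'[OF trivial_limit_at_top_linorder] by auto
    have "f s - f 1 \<le> deriv f s * (s - 1)" using tangent[of 1 s] s by auto
    also have "\<dots> \<le> z * (s - 1)" using z s by (intro mult_right_mono) auto
    also have "\<dots> \<le> \<bar>z\<bar> * (s - 1)" using s by (intro mult_right_mono) auto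
    also have "\<dots> \<le> \<bar>z\<bar> * s" by (intro mult_left_mono) auto
    finally have "f s \<le> \<bar>f 1\<bar> + \<bar>z\<bar> * s" by linarith
    moreover have "\<bar>f 1\<bar> * 1 \<le> \<bar>f 1\<bar> * s" using s by (intro mult_left_mono) auto
    moreover have "(\<bar>f 1\<bar> + \<bar>z\<bar> + 1) * s \<le> f s" using s by (simp add: field_simps)
    ultimately show False using s by (simp add: algebra_simps)
  qed
  then obtain h where h: "h > 1" "deriv f h \<ge> z" by auto
  show ?thesis
  proof (cases "l \<le> h")
    case True
    have "continuous_on {l..h} (deriv f)"
      by (rule continuous_on_subset[OF continuous_deriv]) (use l in auto)
    from IVT'[OF l(2) h(2) True this] obtain a where "l \<le> a" "deriv f a = z" by blast
    with l show ?thesis by (intro exI[of _ a]) auto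
  next
    case False
    then have "deriv f h < deriv f l" using h(1) by (intro deriv_strict_mono) auto
    with l(2) h(2) show ?thesis by linarith
  qed
qed

lemma image_deriv: "deriv f ` {0<..} = UNIV"
proof -
  have "z \<in> deriv f ` {0<..}" for z
  proof -
    obtain a where "a > 0" "deriv f a = z" using deriv_surj[of z] by (elim exE conjE)
    then show ?thesis by (intro image_eqI[of _ _ a]) simp_all
  qed
  then show ?thesis by (intro set_eqI) (simp only: UNIV_I)
qed

lemma deriv_inv_pos: "deriv_inv f z > 0"
  using inv_into_into[of z "deriv f" "{0<..}"] image_deriv by (simp add: deriv_inv_def)

lemma deriv_deriv_inv: "deriv f (deriv_inv f z) = z"
  unfolding deriv_inv_def by (rule f_inv_into_f) (simp add: image_deriv)

lemma deriv_inv_deriv: "a > 0 \<Longrightarrow> deriv_inv f (deriv f a) = a"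
  unfolding deriv_inv_def by (rule inv_into_f_f[OF inj_on_deriv]) simp

lemma deriv_inv_less_iff: "deriv_inv f z < deriv_inv f w \<longleftrightarrow> z < w"
  using deriv_less_iff[OF deriv_inv_pos deriv_inv_pos, of z w] by (simp add: deriv_deriv_inv)

lemma deriv_inv_le_iff: "deriv_inv f z \<le> deriv_inv f w \<longleftrightarrow> z \<le> w"
  using deriv_inv_less_iff[of w z] by (simp flip: not_less)

text \<open>The inverse of an injective continuous map on an open set is continuous; here the set is
  \<open>{0<..}\<close> and the image is the whole line.\<close>

lemma continuous_deriv_inv [continuous_intros]:
  assumes "continuous_on A h"
  shows "continuous_on A (\<lambda>x. deriv_inv f (h x))"
proof -
  have "continuous_on UNIV (deriv_inv f)"
    unfolding image_deriv[symmetric]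
    by (rule continuous_on_inverse_open[OF _ continuous_deriv]) (auto simp: deriv_inv_deriv)
  from this assms subset_UNIV show ?thesis by (rule continuous_on_compose2)
qed

text \<open>The point of slope zero is a global minimum. On the bounded set \<open>Y\<close> this
  makes the negative part of the energy finite.\<close>

lemma bounded_below: "\<exists>m. \<forall>s\<ge>0. m \<le> f s"
proof -
  obtain a where "a > 0" "deriv f a = 0" using deriv_surj[of 0] by blast
  then have "f a \<le> f s" if "s \<ge> 0" for s using tangent[of s a] that by auto
  then show ?thesis by (intro exI[of _ "f a"]) simp
qed

text \<open>Outside \<open>[0,\<infinity>)\<close> resp. \<open>(0,\<infinity>)\<close> the functions \<open>f\<close> and \<open>deriv f\<close> need not be measurable.\<close>

lemma borel_measurable_if_pos:
  fixes h :: "real \<Rightarrow> real"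
  assumes "continuous_on {0<..} h"
  shows "(\<lambda>s. if s > 0 then h s else a) \<in> borel_measurable borel"
proof -
  have "(\<lambda>s. if s \<in> {0<..} then h s else a) \<in> borel_measurable borel"
    by (rule borel_measurable_continuous_on_if[OF _ assms]) auto
  then show ?thesis unfolding greaterThan_iff .
qed

lemmas borel_measurable_deriv = borel_measurable_if_pos[OF continuous_deriv, of 0]

lemma borel_measurable_comp:
  assumes [measurable]: "g \<in> borel_measurable M" and "\<And>x. g x \<ge> 0"
  shows "(\<lambda>x. f (g x)) \<in> borel_measurable M"
proof -
  have "(\<lambda>x. f (g x)) = (\<lambda>s. if s > 0 then f s else f 0) \<circ> g"
    using assms(2) by (auto simp: fun_eq_iff not_less intro!: arg_cong[of _ _ f] antisym)
  moreover have "(\<lambda>s. if s > 0 then f s else f 0) \<in> borel_measurable borel"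
    by (intro borel_measurable_if_pos differentiable_imp_continuous_on differentiable)
  ultimately show ?thesis using measurable_comp[OF assms(1)] by simp
qed

section \<open>The normalizing level given by \<open>K_inv\<close>\<close>

context
  fixes b M :: real
  assumes b: "b > 0" and M: "M \<ge> 0"
begin

lemma set_integrable_deriv_inv:
  "set_integrable lborel {0<..<b} (\<lambda>y. deriv_inv f (z - - M * \<bar>y\<bar>))"
proof (rule set_integrable_subset)
  have "continuous_on {0..b} (\<lambda>y. deriv_inv f (z - - M * \<bar>y\<bar>))"
    by (intro continuous_intros)
  then show "set_integrable lborel {0..b} (\<lambda>y. deriv_inv f (z - - M * \<bar>y\<bar>))"
    unfolding set_integrable_def by (rule borel_integrable_compact[OF compact_Icc])
qed auto

text \<open>Positive length of \<open>{0<..<b}\<close> turns the strict inequality of the integrands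
  into one of the integrals.\<close>

lemma strict_mono_LINT_deriv_inv:
  "strict_mono (\<lambda>z. LINT y:{0<..<b}|lborel. deriv_inv f (z - - M * \<bar>y\<bar>))"
proof (rule strict_monoI)
  fix z w :: real
  assume "z < w"
  let ?R = "restrict_space lborel {0<..<b}"
  have int: "integrable ?R (\<lambda>y. deriv_inv f (u - - M * \<bar>y\<bar>))" for u
    using set_integrable_deriv_inv[of u]
    by (simp add: integrable_restrict_space set_integrable_def)
  have LINT: "(LINT y:{0<..<b}|lborel. deriv_inv f (u - - M * \<bar>y\<bar>)) =
      integral\<^sup>L ?R (\<lambda>y. deriv_inv f (u - - M * \<bar>y\<bar>))" for u
    by (simp add: integral_restrict_space set_lebesgue_integral_def)
  have "emeasure ?R (space ?R) \<noteq> 0"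
    using b by (simp add: emeasure_restrict_space space_restrict_space)
  then show "(LINT y:{0<..<b}|lborel. deriv_inv f (z - - M * \<bar>y\<bar>)) <
        (LINT y:{0<..<b}|lborel. deriv_inv f (w - - M * \<bar>y\<bar>))"
    unfolding LINT using \<open>z < w\<close>
    by (intro finite_measure.integral_less_AE_space finite_measureI int)
       (use b in \<open>auto simp: deriv_inv_less_iff emeasure_restrict_space\<close>)
qed

text \<open>Passing to the compact interval \<open>cbox 0 b\<close>, which has the same integral,
  makes continuity of parameter integrals applicable.\<close>

lemma continuous_LINT_deriv_inv:
  "continuous_on A (\<lambda>z. LINT y:{0<..<b}|lborel. deriv_inv f (z - - M * \<bar>y\<bar>))"
proof -
  have "(LINT y:{0<..<b}|lborel. deriv_inv f (z - - M * \<bar>y\<bar>)) =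
      integral (cbox 0 b) (\<lambda>y. deriv_inv f (z - - M * \<bar>y\<bar>))" for z
    using set_borel_integral_eq_integral(2)[OF set_integrable_deriv_inv]
    by (simp add: integral_open_interval_real)
  moreover have "continuous_on A (\<lambda>z. integral (cbox 0 b) (\<lambda>y. deriv_inv f (z - - M * \<bar>y\<bar>)))"
    unfolding case_prod_beta by (intro integral_continuous_on_param[unfolded case_prod_beta] continuous_intros)
  ultimately show ?thesis by simp
qed

text \<open>\<open>K_inv\<close> is a choice of preimage, so the value \<open>1\<close> has to be
  shown to be attained; the intermediate value theorem does this.\<close>

lemma LINT_deriv_inv_K_inv:
  "(LINT y:{0<..<b}|lborel.
      deriv_inv f (K_inv {0<..<b} f (\<lambda>y. - M * \<bar>y\<bar>) 1 - - M * \<bar>y\<bar>)) = 1"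
proof -
  define \<Phi> where "\<Phi> z = (LINT y:{0<..<b}|lborel. deriv_inv f (z - - M * \<bar>y\<bar>))" for z
  \<comment> \<open>\<open>?h\<close> is the slope at the uniform density \<open>1 / b\<close>. With
    \<open>z = ?h\<close> the integrand is at least \<open>1 / b\<close>; with \<open>z = ?l\<close>
    it is at most \<open>1 / b\<close>, since \<open>M * y\<close> is at most
    \<open>M * b\<close>.\<close>
  let ?h = "deriv f (1 / b)"
  let ?l = "?h - M * b"
  have int: "set_integrable lborel {0<..<b} (\<lambda>y. deriv_inv f ?h)"
    unfolding set_integrable_def using b by (intro integrable_scaleR_left integrable_real_indicator) auto
  have const: "(LINT y:{0<..<b}|lborel. deriv_inv f ?h) = 1"
    using b by (simp add: set_lebesgue_integral_def deriv_inv_deriv)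
  have "\<Phi> ?l \<le> (LINT y:{0<..<b}|lborel. deriv_inv f ?h)"
    unfolding \<Phi>_def
  proof (rule set_integral_mono[OF set_integrable_deriv_inv int])
    fix y assume "y \<in> {0<..<b}"
    then have "M * y \<le> M * b" using M by (intro mult_left_mono) auto
    then show "deriv_inv f (?l - - M * \<bar>y\<bar>) \<le> deriv_inv f ?h"
      using \<open>y \<in> _\<close> by (simp add: deriv_inv_le_iff)
  qed
  then have "\<Phi> ?l \<le> 1" unfolding const .
  moreover have "(LINT y:{0<..<b}|lborel. deriv_inv f ?h) \<le> \<Phi> ?h"
    unfolding \<Phi>_def using M
    by (intro set_integral_mono[OF int set_integrable_deriv_inv]) (simp add: deriv_inv_le_iff)
  then have "1 \<le> \<Phi> ?h" unfolding const .
  moreover have "?l \<le> ?h" using M b by simp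
  moreover have "continuous_on {?l..?h} \<Phi>"
    unfolding \<Phi>_def by (rule continuous_LINT_deriv_inv)
  ultimately obtain z where "\<Phi> z = 1" using IVT'[of \<Phi> ?l 1 ?h] by auto
  then have "\<Phi> (inv \<Phi> 1) = 1" by (intro f_inv_into_f) auto
  moreover have "K_inv {0<..<b} f (\<lambda>y. - M * \<bar>y\<bar>) = inv \<Phi>"
    by (simp add: K_inv_def \<Phi>_def[abs_def])
  ultimately show ?thesis by (simp add: \<Phi>_def)
qed

text \<open>Contrapositive of strict monotonicity: a lower bound on a mass becomes an upper bound on
  the level \<open>K_inv\<close>.\<close>

lemma K_inv_le:
  assumes "1 \<le> (LINT y:{0<..<b}|lborel. deriv_inv f (z - - M * \<bar>y\<bar>))"
  shows "K_inv {0<..<b} f (\<lambda>y. - M * \<bar>y\<bar>) 1 \<le> z"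
proof (rule ccontr)
  assume "\<not> ?thesis"
  then have "z < K_inv {0<..<b} f (\<lambda>y. - M * \<bar>y\<bar>) 1" by simp
  from strict_monoD[OF strict_mono_LINT_deriv_inv this] assms show False
    unfolding LINT_deriv_inv_K_inv by linarith
qed

end
end

subsection \<open>The cost is Lipschitz in the second variable\<close>

text \<open>\<open>D\<close> is the total derivative in the direction of \<open>Y\<close>, bounded
  because it extends continuously to the compact closure. The bound serves the Lipschitz estimate
  and the finiteness of \<open>k_max\<close>, continuity the measurability of superlevel
  sets.\<close>

lemma C2_closure_has_partial_derivative:
  fixes X :: "'a::euclidean_space set" and Y :: "real set"
  assumes X: "bounded X" and Y: "bounded Y"
    and c: "C2_closure (X \<times> Y) (\<lambda>(x, y). c x y)"
  obtains D B where
    "\<And>x y. x \<in> X \<Longrightarrow> y \<in> Y \<Longrightarrow> (c x has_real_derivative D (x, y)) (at y)"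
    "continuous_on (X \<times> Y) D" "\<And>p. p \<in> X \<times> Y \<Longrightarrow> \<bar>D p\<bar> \<le> B"
proof -
  obtain g' :: "'a \<times> real \<Rightarrow> ('a \<times> real) \<Rightarrow>\<^sub>L real" where
    cont: "continuous_on (closure (X \<times> Y)) g'"
    and der: "\<And>p. p \<in> X \<times> Y \<Longrightarrow> ((\<lambda>(x, y). c x y) has_derivative blinfun_apply (g' p)) (at p)"
    using c unfolding C2_closure_def by blast
  define D where "D p = blinfun_apply (g' p) (0, 1)" for p
  have contD: "continuous_on (closure (X \<times> Y)) D"
    unfolding D_def by (intro continuous_intros cont)
  have "compact (D ` closure (X \<times> Y))"
    by (intro compact_continuous_image contD) (simp add: X Y bounded_Times compact_closure)
  then obtain B where B: "\<And>p. p \<in> closure (X \<times> Y) \<Longrightarrow> \<bar>D p\<bar> \<le> B"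
    using compact_imp_bounded[of "D ` closure (X \<times> Y)"] unfolding bounded_iff by auto
  show thesis
  proof
    fix x y assume "x \<in> X" "y \<in> Y"
    then have "((\<lambda>(x, y). c x y) has_derivative blinfun_apply (g' (x, y))) (at (x, y))"
      by (intro der) auto
    \<comment> \<open>Chain rule along the line through \<open>(x, y)\<close> in the direction of
      \<open>Y\<close>.\<close>
    then have "((\<lambda>(x, y). c x y) \<circ> Pair x has_derivative blinfun_apply (g' (x, y)) \<circ> (\<lambda>h. (0, h))) (at y)"
      by (intro diff_chain_at) (auto intro!: derivative_eq_intros)
    moreover have "blinfun_apply (g' (x, y)) (0, h) = D (x, y) * h" for h
      unfolding D_def using blinfun.scaleR_right[of "g' (x, y)" h "(0, 1)"] by (simp add: mult.commute)
    ultimately show "(c x has_real_derivative D (x, y)) (at y)"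
      by (simp add: has_field_derivative_def comp_def)
  next
    show "continuous_on (X \<times> Y) D" by (rule continuous_on_subset[OF contD closure_subset])
  next
    fix p assume "p \<in> X \<times> Y"
    then show "\<bar>D p\<bar> \<le> B" using B closure_subset[of "X \<times> Y"] by auto
  qed
qed

text \<open>The bounded derivative gives the estimate on \<open>X\<close> and \<open>Y\<close>
  themselves. The set where a continuous function is nonpositive is closed, so the estimate passes
  to the closures.\<close>

lemma C2_closure_Lipschitz:
  fixes X :: "'a::euclidean_space set" and Y :: "real set"
  assumes X: "bounded X" and Y: "bounded Y" "convex Y"
    and c: "C2_closure (X \<times> Y) (\<lambda>(x, y). c x y)"
  obtains B where "\<And>x y0 y1. x \<in> closure X \<Longrightarrow> y0 \<in> closure Y \<Longrightarrow> y1 \<in> closure Y \<Longrightarrow>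
    \<bar>c x y0 - c x y1\<bar> \<le> B * \<bar>y0 - y1\<bar>"
proof -
  obtain D B where der: "\<And>x y. x \<in> X \<Longrightarrow> y \<in> Y \<Longrightarrow> (c x has_real_derivative D (x, y)) (at y)"
    and B: "\<And>p. p \<in> X \<times> Y \<Longrightarrow> \<bar>D p\<bar> \<le> B"
    by (rule C2_closure_has_partial_derivative[OF X Y(1) c]) blast
  have cont: "continuous_on (closure X \<times> closure Y) (\<lambda>p. c (fst p) (snd p))"
    using c by (simp add: C2_closure_def closure_Times case_prod_beta')
  let ?h = "\<lambda>(x, y0, y1). \<bar>c x y0 - c x y1\<bar> - B * \<bar>y0 - y1\<bar>"
  have comp: "continuous_on A (\<lambda>z. c (u z) (v z))"
    if "continuous_on A u" "continuous_on A v" "\<And>z. z \<in> A \<Longrightarrow> u z \<in> closure X \<and> v z \<in> closure Y"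
    for A :: "('a \<times> real \<times> real) set" and u v
  proof -
    have "continuous_on A (\<lambda>z. (u z, v z))" "(\<lambda>z. (u z, v z)) ` A \<subseteq> closure X \<times> closure Y"
      using that by (auto intro!: continuous_on_Pair)
    from continuous_on_compose2[OF cont this] show ?thesis by simp
  qed
  have h: "continuous_on (closure (X \<times> Y \<times> Y)) ?h"
    unfolding case_prod_beta
    by (intro continuous_intros comp) (auto simp: closure_Times)
  have "\<bar>c x y0 - c x y1\<bar> - B * \<bar>y0 - y1\<bar> \<le> 0" if "x \<in> X" "y0 \<in> Y" "y1 \<in> Y" for x y0 y1
    using field_differentiable_bound[of Y "c x" "\<lambda>y. D (x, y)" B y0 y1] Y(2) B der that
    by (simp add: has_field_derivative_at_within abs_minus_commute)
  then have "?h p \<le> 0" if "p \<in> closure (X \<times> Y \<times> Y)" for p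
    using continuous_le_on_closure[OF h that] by fastforce
  from this[of "(_, _, _)"] show thesis by (intro that[of B]) (auto simp: closure_Times)
qed

text \<open>A real supremum is sure to bound its elements only when the set is bounded above;
  \<open>C2_closure_Lipschitz\<close> supplies this.\<close>

lemma M_c_Lipschitz:
  fixes X :: "'a::euclidean_space set" and Y :: "real set"
  assumes X: "bounded X" and Y: "bounded Y" "convex Y"
    and c: "C2_closure (X \<times> Y) (\<lambda>(x, y). c x y)"
    and mem: "x \<in> closure X" "y0 \<in> closure Y" "y1 \<in> closure Y"
  shows "\<bar>c x y0 - c x y1\<bar> \<le> M_c X Y c * \<bar>y0 - y1\<bar>"
proof (cases "y0 = y1")
  case False
  obtain B where B: "\<And>x y0 y1. x \<in> closure X \<Longrightarrow> y0 \<in> closure Y \<Longrightarrow> y1 \<in> closure Y \<Longrightarrow>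
      \<bar>c x y0 - c x y1\<bar> \<le> B * \<bar>y0 - y1\<bar>"
    by (rule C2_closure_Lipschitz[OF X Y c]) blast
  let ?S = "{(x, y0, y1). x \<in> closure X \<and> y0 \<in> closure Y \<and> y1 \<in> closure Y \<and> y0 \<noteq> y1}"
  let ?q = "\<lambda>(x, y0, y1). \<bar>c x y0 - c x y1\<bar> / \<bar>y0 - y1\<bar>"
  have "bdd_above (?q ` ?S)"
    using B by (intro bdd_aboveI[of _ B]) (auto simp: pos_divide_le_eq)
  then have "?q (x, y0, y1) \<le> (SUP p\<in>?S. ?q p)"
    using mem False by (intro cSUP_upper) auto
  with False show ?thesis by (simp add: M_c_def pos_divide_le_eq)
qed simp

subsection \<open>Transport cost under a small displacement\<close>

lemma borel_probsD:
  assumes "M \<in> borel_probs S"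
  shows "prob_space M" "sets M = sets borel" "emeasure M S = 1"
  using assms by (auto simp: borel_probs_def)

lemma borel_probs_AE:
  assumes M: "M \<in> borel_probs S" and S: "S \<in> sets borel"
  shows "AE x in M. x \<in> S"
proof -
  interpret prob_space M using borel_probsD(1)[OF M] .
  show ?thesis
    using borel_probsD[OF M] S
    by (intro AE_in_set_eq_1[THEN iffD2]) (auto simp: measure_def)
qed

context
  fixes X :: "'a::euclidean_space set" and Y :: "real set"
    and c :: "'a \<Rightarrow> real \<Rightarrow> real" and \<mu> :: "'a measure"
  assumes X: "bounded X" "open X" and Y: "bounded Y"
    and cont: "continuous_on (closure X \<times> closure Y) (\<lambda>p. c (fst p) (snd p))"
    and \<mu>: "\<mu> \<in> borel_probs X"
begin

lemma sets_coupling: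
  assumes "\<gamma> \<in> couplings \<mu> \<nu>"
  shows "sets \<gamma> = sets (borel \<Otimes>\<^sub>M (borel :: real measure))"
  using assms by (subst borel_prod) (simp add: couplings_def)

lemma prob_space_coupling:
  assumes "\<gamma> \<in> couplings \<mu> (\<nu> :: real measure)"
  shows "prob_space \<gamma>"
proof -
  have [measurable_cong]: "sets \<gamma> = sets (borel \<Otimes>\<^sub>M borel)" using sets_coupling[OF assms] .
  have "prob_space (distr \<gamma> borel fst)"
    using assms borel_probsD(1)[OF \<mu>] by (simp add: couplings_def)
  then show ?thesis by (rule prob_space_distrD[rotated]) measurable
qed

text \<open>The two marginals confine a coupling to the product of the closures, the region where
  \<open>c\<close> is controlled.\<close>

lemma AE_coupling:
  assumes \<gamma>: "\<gamma> \<in> couplings \<mu> \<nu>" and \<nu>: "\<nu> \<in> borel_probs (closure Y)"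
  shows "AE p in \<gamma>. p \<in> closure X \<times> closure Y"
proof -
  have [measurable_cong]: "sets \<gamma> = sets (borel \<Otimes>\<^sub>M borel)"
    using sets_coupling[OF \<gamma>] .
  have "AE x in distr \<gamma> borel fst. x \<in> X" "AE y in distr \<gamma> borel snd. y \<in> closure Y"
    using \<gamma> borel_probs_AE[OF \<mu>] borel_probs_AE[OF \<nu>] X by (auto simp: couplings_def)
  then have "AE p in \<gamma>. fst p \<in> X" "AE p in \<gamma>. snd p \<in> closure Y"
    using X by (simp_all add: AE_distr_iff)
  then show ?thesis
    by eventually_elim (use closure_subset in \<open>auto simp: mem_Times_iff\<close>)
qed

lemma cost_measurable:
  "(\<lambda>p. indicator (closure X \<times> closure Y) p *\<^sub>R c (fst p) (snd p)) \<in> borel_measurable borel"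
  by (intro borel_measurable_continuous_on_indicator cont) (simp add: closed_Times borel_closed)

lemma cost_bounded:
  obtains B where "\<And>p. \<bar>indicator (closure X \<times> closure Y) p *\<^sub>R c (fst p) (snd p)\<bar> \<le> B"
proof -
  have "compact ((\<lambda>p. c (fst p) (snd p)) ` (closure X \<times> closure Y))"
    using X Y by (intro compact_continuous_image cont) (simp add: compact_Times compact_closure)
  from compact_imp_bounded[OF this]
  obtain B where *: "\<forall>x\<in>(\<lambda>p. c (fst p) (snd p)) ` (closure X \<times> closure Y). norm x \<le> B"
    unfolding bounded_iff by blast
  then have B: "\<bar>c (fst p) (snd p)\<bar> \<le> B" if "p \<in> closure X \<times> closure Y" for p
    using bspec[OF * imageI[OF that]] by simp
  show thesis
  proof (rule that)
    fix p show "\<bar>indicator (closure X \<times> closure Y) p *\<^sub>R c (fst p) (snd p)\<bar> \<le> \<bar>B\<bar>"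
      using B[of p] by (cases "p \<in> closure X \<times> closure Y") auto
  qed
qed

text \<open>All couplings have cost bounded by that of \<open>c\<close> on a compact set, and the
  product measure shows that couplings exist. Finiteness allows transport costs to be cancelled in
  the minimality inequality.\<close>

lemma transport_cost_finite:
  assumes \<nu>: "\<nu> \<in> borel_probs (closure Y)"
  shows "\<bar>transport_cost X Y c \<mu> \<nu>\<bar> \<noteq> \<infinity>"
proof -
  let ?h = "\<lambda>p. indicator (closure X \<times> closure Y) p *\<^sub>R c (fst p) (snd p)"
  obtain B where B: "\<And>p. \<bar>?h p\<bar> \<le> B" using cost_bounded by blast
  interpret \<mu>: prob_space \<mu> using borel_probsD[OF \<mu>] by simp
  interpret \<nu>: prob_space \<nu> using borel_probsD[OF \<nu>] by simp
  have sets[measurable_cong]: "sets \<mu> = sets borel" "sets \<nu> = sets borel"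
    using borel_probsD[OF \<mu>] borel_probsD[OF \<nu>] by auto
  interpret pair_sigma_finite \<nu> \<mu> ..
  have "distr (\<mu> \<Otimes>\<^sub>M \<nu>) borel fst = distr (\<mu> \<Otimes>\<^sub>M \<nu>) \<mu> fst"
    by (intro distr_cong) (simp_all add: sets)
  then have 1: "distr (\<mu> \<Otimes>\<^sub>M \<nu>) borel fst = \<mu>" by (simp add: \<nu>.distr_pair_fst)
  \<comment> \<open>The second marginal is read off as the first marginal of the swapped
    product.\<close>
  have "distr (\<mu> \<Otimes>\<^sub>M \<nu>) borel snd = distr (\<nu> \<Otimes>\<^sub>M \<mu>) \<nu> fst"
    by (subst distr_pair_swap)
       (auto simp: distr_distr sets comp_def case_prod_beta intro!: distr_cong)
  then have 2: "distr (\<mu> \<Otimes>\<^sub>M \<nu>) borel snd = \<nu>" by (simp add: \<mu>.distr_pair_fst)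
  have "sets (\<mu> \<Otimes>\<^sub>M \<nu>) = sets borel"
    using sets_pair_measure_cong[OF sets] by (subst (asm) borel_prod)
  with 1 2 have prod: "\<mu> \<Otimes>\<^sub>M \<nu> \<in> couplings \<mu> \<nu>"
    by (simp add: couplings_def)
  have bound: "\<bar>LINT p:closure X \<times> closure Y|\<gamma>. c (fst p) (snd p)\<bar> \<le> B"
    if "\<gamma> \<in> couplings \<mu> \<nu>" for \<gamma>
  proof -
    interpret prob_space \<gamma> using prob_space_coupling[OF that] .
    have "?h \<in> borel_measurable \<gamma>"
      using cost_measurable that by (simp add: couplings_def measurable_cong_sets[of \<gamma> borel])
    then have "integrable \<gamma> ?h" by (intro integrable_const_bound[of _ B]) (use B in auto)
    then have "\<bar>expectation ?h\<bar> \<le> expectation (\<lambda>p. B)"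
      by (intro order.trans[OF integral_abs_bound] integral_mono) (use B in auto)
    then show ?thesis by (simp add: set_lebesgue_integral_def prob_space)
  qed
  have "transport_cost X Y c \<mu> \<nu> \<le> ereal B"
    unfolding transport_cost_def using bound[OF prod] by (intro INF_lower2[OF prod]) auto
  moreover have "ereal (- B) \<le> transport_cost X Y c \<mu> \<nu>"
    unfolding transport_cost_def using bound by (intro INF_greatest) (force simp: abs_le_iff minus_le_iff)
  ultimately show ?thesis by auto
qed

text \<open>
  A coupling \<open>\<gamma>\<close> is split according to which part of the mass moves on \<open>\<gamma> \<Otimes> bool\<close>, the boolean
  telling whether a particle moves; the perturbed coupling is then a single push-forward.
\<close>

lemma transport_cost_shift:
  fixes g :: "real \<Rightarrow> real" and A :: "real set"
  assumes [measurable]: "g \<in> borel_measurable borel" "A \<in> sets borel"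
    and g: "\<And>y. g y \<ge> 0" and \<epsilon>: "\<epsilon> > 0" "\<And>y. y \<in> A \<Longrightarrow> \<epsilon> \<le> g y"
    and A: "A \<subseteq> Y" "\<And>y. y \<in> A \<Longrightarrow> y + t \<in> Y"
    and L: "L \<ge> 0" "\<And>x y. x \<in> closure X \<Longrightarrow> y \<in> A \<Longrightarrow> c x (y + t) \<le> c x y + L"
    and \<nu>: "density lborel (\<lambda>y. ennreal (g y)) \<in> borel_probs (closure Y)" (is "?\<nu> \<in> _")
  defines "\<nu>' \<equiv> density lborel (\<lambda>y. ennreal (g y - \<epsilon> * indicator A y + \<epsilon> * indicator A (y - t)))"
  shows "transport_cost X Y c \<mu> \<nu>' \<le> transport_cost X Y c \<mu> ?\<nu> + ereal (L * (\<epsilon> * measure lborel A))"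
proof -
  define S where "S = closure X \<times> closure Y"
  define h where "h p = indicator S p *\<^sub>R c (fst p) (snd p)" for p
  \<comment> \<open>\<open>\<phi> y\<close> is the fraction of the mass at \<open>y\<close> that
    moves, chosen so that density \<open>\<epsilon>\<close> leaves \<open>A\<close>. Off
    \<open>A\<close> the numerator is zero, so a vanishing \<open>g y\<close> does no harm.\<close>
  define \<phi> where "\<phi> y = \<epsilon> * indicator A y / g y" for y
  define w where "w p = ennreal (if snd p then \<phi> (snd (fst p)) else 1 - \<phi> (snd (fst p)))"
    for p :: "('a \<times> real) \<times> bool"
  \<comment> \<open>Because of the test for \<open>A\<close>, \<open>R\<close> keeps the pair
    wherever \<open>y\<close> lies outside \<open>A\<close>, even on the null set flagged as moving;
    the pointwise cost estimate relies on this.\<close>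
  define R where "R p = (fst (fst p), if snd p \<and> snd (fst p) \<in> A then snd (fst p) + t else snd (fst p))"
    for p :: "('a \<times> real) \<times> bool"
  have [measurable]: "\<phi> \<in> borel_measurable borel" unfolding \<phi>_def by measurable
  have \<phi>: "0 \<le> \<phi> y" "\<phi> y \<le> 1" "g y * \<phi> y = \<epsilon> * indicator A y" for y
    using \<epsilon>(1) \<epsilon>(2)[of y] g[of y] by (auto simp: \<phi>_def indicator_def divide_le_eq)
  have "emeasure lborel A < \<infinity>"
    using bounded_subset[OF Y A(1)] by (intro emeasure_bounded_finite)
  then have A_fin: "emeasure lborel A = ennreal (measure lborel A)"
    by (intro emeasure_eq_ennreal_measure) auto
  have step: "\<exists>\<gamma>'\<in>couplings \<mu> \<nu>'. (LINT p:S|\<gamma>'. c (fst p) (snd p)) \<le>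
      (LINT p:S|\<gamma>. c (fst p) (snd p)) + L * (\<epsilon> * measure lborel A)"
    if \<gamma>: "\<gamma> \<in> couplings \<mu> ?\<nu>" for \<gamma>
  proof -
    interpret prob_space \<gamma> using prob_space_coupling[OF \<gamma>] .
    interpret B: sigma_finite_measure "count_space (UNIV :: bool set)"
      by (rule sigma_finite_measure_count_space_finite) simp
    have [measurable_cong]: "sets \<gamma> = sets (borel \<Otimes>\<^sub>M borel)" using sets_coupling[OF \<gamma>] .
    define W where "W = density (\<gamma> \<Otimes>\<^sub>M count_space UNIV) w"
    have [measurable_cong]: "sets W = sets ((borel \<Otimes>\<^sub>M borel) \<Otimes>\<^sub>M count_space UNIV)"
      unfolding W_def sets_density by (rule sets_pair_measure_cong[OF sets_coupling[OF \<gamma>] refl])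
    have [measurable]: "w \<in> borel_measurable ((borel \<Otimes>\<^sub>M borel) \<Otimes>\<^sub>M count_space UNIV)"
      unfolding w_def by measurable
    have R[measurable]: "R \<in> W \<rightarrow>\<^sub>M borel"
      unfolding R_def borel_prod[symmetric] by measurable
    have W: "(\<integral>\<^sup>+p. H p \<partial>W) =
        (\<integral>\<^sup>+q. ennreal (1 - \<phi> (snd q)) * H (q, False) + ennreal (\<phi> (snd q)) * H (q, True) \<partial>\<gamma>)"
      if [measurable]: "H \<in> borel_measurable ((borel \<Otimes>\<^sub>M borel) \<Otimes>\<^sub>M count_space UNIV)" for H
    proof -
      have "(\<integral>\<^sup>+p. H p \<partial>W) = (\<integral>\<^sup>+p. w p * H p \<partial>(\<gamma> \<Otimes>\<^sub>M count_space UNIV))"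
        unfolding W_def by (rule nn_integral_density) measurable
      also have "\<dots> = (\<integral>\<^sup>+q. \<integral>\<^sup>+b. w (q, b) * H (q, b) \<partial>count_space UNIV \<partial>\<gamma>)"
        by (rule B.nn_integral_fst[symmetric]) measurable
      also have "\<dots> = (\<integral>\<^sup>+q. ennreal (1 - \<phi> (snd q)) * H (q, False) + ennreal (\<phi> (snd q)) * H (q, True) \<partial>\<gamma>)"
        by (simp add: nn_integral_count_space_finite UNIV_bool w_def)
      finally show ?thesis .
    qed
    have \<gamma>_snd: "(\<integral>\<^sup>+q. H (snd q) \<partial>\<gamma>) = (\<integral>\<^sup>+y. ennreal (g y) * H y \<partial>lborel)"
      if [measurable]: "H \<in> borel_measurable borel" for H
    proof -
      have "(\<integral>\<^sup>+q. H (snd q) \<partial>\<gamma>) = (\<integral>\<^sup>+y. H y \<partial>distr \<gamma> borel snd)"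
        by (subst nn_integral_distr) simp_all
      also have "distr \<gamma> borel snd = ?\<nu>" using \<gamma> by (simp add: couplings_def)
      finally show ?thesis by (simp add: nn_integral_density)
    qed
    \<comment> \<open>The weights of staying and moving add up to one, so forgetting the flag
      returns \<open>\<gamma>\<close>.\<close>
    have fst_W: "distr W \<gamma> fst = \<gamma>"
    proof (rule measure_eqI)
      fix E assume "E \<in> sets (distr W \<gamma> fst)"
      then have E[measurable]: "E \<in> sets (borel \<Otimes>\<^sub>M borel)" and E': "E \<in> sets \<gamma>"
        using sets_coupling[OF \<gamma>] by auto
      have "emeasure (distr W \<gamma> fst) E = (\<integral>\<^sup>+p. indicator E p \<partial>distr W \<gamma> fst)"
        using E' by simp
      also have "\<dots> = (\<integral>\<^sup>+p. indicator E (fst p) \<partial>W)"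
        by (subst nn_integral_distr) simp_all
      also have "\<dots> = (\<integral>\<^sup>+q. indicator E q \<partial>\<gamma>)"
        by (subst W) (simp_all add: \<phi> flip: distrib_right ennreal_plus)
      finally show "emeasure (distr W \<gamma> fst) E = emeasure \<gamma> E"
        using E' by simp
    qed simp
    have "prob_space (distr W \<gamma> fst)" unfolding fst_W by unfold_locales
    then interpret W: prob_space W by (rule prob_space_distrD[rotated]) measurable
    define \<gamma>' where "\<gamma>' = distr W borel R"
    have [measurable]: "fst \<in> borel_measurable (borel :: ('a \<times> real) measure)"
      "snd \<in> borel_measurable (borel :: ('a \<times> real) measure)"
      by (intro borel_measurable_continuous_onI continuous_intros)+
    have "distr \<gamma>' borel fst = distr W borel (\<lambda>p. fst (fst p))"
      unfolding \<gamma>'_def by (subst distr_distr) (auto simp: comp_def R_def)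
    also have "\<dots> = distr (distr W \<gamma> fst) borel fst"
      by (subst distr_distr) (auto simp: comp_def)
    also have "\<dots> = \<mu>" using \<gamma> unfolding fst_W by (simp add: couplings_def)
    finally have fst: "distr \<gamma>' borel fst = \<mu>" .
    have snd: "distr \<gamma>' borel snd = \<nu>'"
    proof (rule measure_eqI)
      fix E assume "E \<in> sets (distr \<gamma>' borel snd)"
      then have [measurable]: "E \<in> sets borel" by simp
      have "distr \<gamma>' borel snd = distr W borel (\<lambda>p. snd (R p))"
        unfolding \<gamma>'_def by (subst distr_distr) (auto simp: comp_def)
      then have "emeasure (distr \<gamma>' borel snd) E = (\<integral>\<^sup>+y. indicator E y \<partial>distr W borel (\<lambda>p. snd (R p)))"
        by simp
      also have "\<dots> = (\<integral>\<^sup>+p. indicator E (snd (R p)) \<partial>W)"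
        by (subst nn_integral_distr) simp_all
      also have "\<dots> = (\<integral>\<^sup>+q. ennreal (1 - \<phi> (snd q)) * indicator E (snd q)
          + ennreal (\<phi> (snd q)) * indicator E (snd q + t) \<partial>\<gamma>)"
        unfolding R_def by (subst W) (auto intro!: nn_integral_cong simp: \<phi>_def)
      also have "\<dots> = (\<integral>\<^sup>+y. ennreal (g y) * (ennreal (1 - \<phi> y) * indicator E y
          + ennreal (\<phi> y) * indicator E (y + t)) \<partial>lborel)"
        by (rule \<gamma>_snd) measurable
      also have "\<dots> = (\<integral>\<^sup>+y. ennreal (g y - \<epsilon> * indicator A y) * indicator E y
          + ennreal (\<epsilon> * indicator A y) * indicator E (y + t) \<partial>lborel)"
        by (intro nn_integral_cong)
           (simp add: distrib_left mult.assoc[symmetric] ennreal_mult[symmetric] g \<phi> right_diff_distrib)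
      also have "\<dots> = (\<integral>\<^sup>+y. ennreal (g y - \<epsilon> * indicator A y) * indicator E y \<partial>lborel)
          + (\<integral>\<^sup>+y. ennreal (\<epsilon> * indicator A y) * indicator E (y + t) \<partial>lborel)"
        by (rule nn_integral_add) measurable
      \<comment> \<open>Translation invariance of Lebesgue measure carries the moved mass from
        \<open>A\<close> to its translate.\<close>
      also have "(\<integral>\<^sup>+y. ennreal (\<epsilon> * indicator A y) * indicator E (y + t) \<partial>lborel) =
          (\<integral>\<^sup>+y. ennreal (\<epsilon> * indicator A (y - t)) * indicator E y \<partial>lborel)"
        by (subst nn_integral_real_affine[of _ 1 "- t"]) (simp_all add: add.commute)
      also have "(\<integral>\<^sup>+y. ennreal (g y - \<epsilon> * indicator A y) * indicator E y \<partial>lborel) + \<dots> =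
          (\<integral>\<^sup>+y. ennreal (g y - \<epsilon> * indicator A y) * indicator E y
            + ennreal (\<epsilon> * indicator A (y - t)) * indicator E y \<partial>lborel)"
        by (rule nn_integral_add[symmetric]) measurable
      also have "\<dots> = (\<integral>\<^sup>+y. ennreal (g y - \<epsilon> * indicator A y + \<epsilon> * indicator A (y - t)) * indicator E y \<partial>lborel)"
        using \<epsilon> g by (intro nn_integral_cong) (auto simp: indicator_def simp flip: ennreal_plus)
      also have "\<dots> = emeasure \<nu>' E"
        unfolding \<nu>'_def by (subst emeasure_density) simp_all
      finally show "emeasure (distr \<gamma>' borel snd) E = emeasure \<nu>' E" .
    qed (simp add: \<nu>'_def)
    have "\<gamma>' \<in> couplings \<mu> \<nu>'" using fst snd by (simp add: couplings_def \<gamma>'_def)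
    moreover have "(LINT p:S|\<gamma>'. c (fst p) (snd p)) \<le>
      (LINT p:S|\<gamma>. c (fst p) (snd p)) + L * (\<epsilon> * measure lborel A)"
    proof -
      \<comment> \<open>\<open>?M\<close> is the event that a particle actually moves. Its mass is
        \<open>\<epsilon>\<close> times the length of \<open>A\<close>, and only there is the
        surcharge \<open>L\<close> paid.\<close>
      let ?M = "{p \<in> space W. snd p \<and> snd (fst p) \<in> A}"
      obtain C where C: "\<And>p. \<bar>h p\<bar> \<le> C" using cost_bounded unfolding h_def S_def by blast
      have h_borel[measurable]: "h \<in> borel_measurable borel"
        unfolding h_def S_def by (rule cost_measurable)
      have h_\<gamma>[measurable]: "h \<in> borel_measurable \<gamma>"
        using h_borel \<gamma> by (simp add: couplings_def measurable_cong_sets[of \<gamma> borel])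
      have [measurable]: "?M \<in> sets W" by measurable
      have "emeasure W ?M = (\<integral>\<^sup>+p. indicator ?M p \<partial>W)"
        by simp
      also have "\<dots> = (\<integral>\<^sup>+p. (if snd p then indicator A (snd (fst p)) else 0) \<partial>W)"
        by (intro nn_integral_cong) (auto simp: indicator_def)
      also have "\<dots> = (\<integral>\<^sup>+q. ennreal (\<phi> (snd q)) * indicator A (snd q) \<partial>\<gamma>)"
        by (subst W) simp_all
      also have "\<dots> = (\<integral>\<^sup>+y. ennreal (g y) * (ennreal (\<phi> y) * indicator A y) \<partial>lborel)"
        by (rule \<gamma>_snd) measurable
      also have "\<dots> = (\<integral>\<^sup>+y. ennreal \<epsilon> * indicator A y \<partial>lborel)"
        using \<epsilon> by (intro nn_integral_cong)
           (simp add: mult.assoc[symmetric] ennreal_mult[symmetric] g \<phi> indicator_def)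
      also have "\<dots> = ennreal (\<epsilon> * measure lborel A)"
        using \<epsilon> by (simp add: nn_integral_cmult_indicator A_fin ennreal_mult)
      finally have M: "W.prob ?M = \<epsilon> * measure lborel A"
        using \<epsilon> by (simp add: measure_def)
      have int1: "integrable W (\<lambda>p. h (fst p))" "integrable W (\<lambda>p. h (R p))"
        by (intro W.integrable_const_bound[of _ C]; use C in simp)+
      have int2: "integrable W (\<lambda>p. indicator ?M p * L)"
        by (intro W.integrable_const_bound[of _ "\<bar>L\<bar>"]) (auto simp: indicator_def)
      have "AE p in distr W \<gamma> fst. p \<in> S"
        using AE_coupling[OF \<gamma> \<nu>] unfolding fst_W S_def .
      then have "AE p in W. fst p \<in> S"
        by (rule AE_distrD[rotated]) measurable
      then have "AE p in W. h (R p) \<le> h (fst p) + indicator ?M p * L"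
        using AE_space
      proof eventually_elim
        case (elim p)
        obtain x y b where p: "p = ((x, y), b)" by (metis prod.collapse)
        show ?case
        proof (cases "b \<and> y \<in> A")
          case True
          then have "(x, y + t) \<in> S" "c x (y + t) \<le> c x y + L"
            using elim A L closure_subset[of Y] by (auto simp: p S_def)
          with True elim show ?thesis by (simp add: p R_def h_def)
        next
          case False
          with elim L show ?thesis by (auto simp: p R_def h_def)
        qed
      qed
      then have "W.expectation (\<lambda>p. h (R p)) \<le> W.expectation (\<lambda>p. h (fst p) + indicator ?M p * L)"
        using int1 int2 by (intro integral_mono_AE) auto
      also have "\<dots> = W.expectation (\<lambda>p. h (fst p)) + W.expectation (\<lambda>p. indicator ?M p * L)"
        using int1 int2 by (intro Bochner_Integration.integral_add)
      also have "W.expectation (\<lambda>p. h (fst p)) = integral\<^sup>L (distr W \<gamma> fst) h"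
        by (subst integral_distr) auto
      also have "\<dots> = integral\<^sup>L \<gamma> h" unfolding fst_W ..
      also have "W.expectation (\<lambda>p. indicator ?M p * L) = L * (\<epsilon> * measure lborel A)"
        using M by simp
      also have "W.expectation (\<lambda>p. h (R p)) = integral\<^sup>L \<gamma>' h"
        unfolding \<gamma>'_def by (subst integral_distr) auto
      finally show ?thesis unfolding set_lebesgue_integral_def h_def .
    qed
    ultimately show ?thesis by blast
  qed
  \<comment> \<open>A finite surcharge can be moved to the left, after which a bound against each
    single coupling suffices for the infimum.\<close>
  have fin: "\<bar>ereal (L * (\<epsilon> * measure lborel A))\<bar> \<noteq> \<infinity>" by simp
  have "transport_cost X Y c \<mu> \<nu>' - ereal (L * (\<epsilon> * measure lborel A)) \<le> transport_cost X Y c \<mu> ?\<nu>"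
    unfolding transport_cost_def[of X Y c \<mu> ?\<nu>]
  proof (rule INF_greatest)
    fix \<gamma> assume "\<gamma> \<in> couplings \<mu> ?\<nu>"
    from step[OF this] obtain \<gamma>' where "\<gamma>' \<in> couplings \<mu> \<nu>'"
      "(LINT p:S|\<gamma>'. c (fst p) (snd p)) \<le> (LINT p:S|\<gamma>. c (fst p) (snd p)) + L * (\<epsilon> * measure lborel A)"
      by blast
    then have "transport_cost X Y c \<mu> \<nu>' \<le>
        ereal ((LINT p:S|\<gamma>. c (fst p) (snd p)) + L * (\<epsilon> * measure lborel A))"
      unfolding transport_cost_def S_def by (intro INF_lower2) auto
    then show "transport_cost X Y c \<mu> \<nu>' - ereal (L * (\<epsilon> * measure lborel A))
        \<le> ereal (LINT p:closure X \<times> closure Y|\<gamma>. c (fst p) (snd p))"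
      unfolding ereal_minus_le[OF fin] S_def by simp
  qed
  then show ?thesis unfolding ereal_minus_le[OF fin] .
qed

end

subsection \<open>Lower bound on the density of a minimizer\<close>

text \<open>\<open>RN_deriv\<close> agrees with \<open>g\<close> almost everywhere, which the
  integrals cannot distinguish; integrability makes both parts finite, so their extended difference
  is the ordinary integral.\<close>

lemma internal_energy_density:
  assumes [measurable]: "g \<in> borel_measurable borel" "Y \<in> sets borel" and g: "\<And>y. g y \<ge> 0"
    and int: "set_integrable lborel Y (\<lambda>y. f (g y))"
  shows "internal_energy Y f (density lborel (\<lambda>y. ennreal (g y))) = ereal (LINT y:Y|lborel. f (g y))"
proof -
  let ?\<nu> = "density lborel (\<lambda>y. ennreal (g y))"
  let ?u = "\<lambda>y. indicator Y y * f (g y)"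
  have "absolutely_continuous lborel ?\<nu>" by (rule absolutely_continuousI_density) measurable
  have "AE y in lborel. ennreal (g y) = RN_deriv lborel ?\<nu> y"
    by (rule sigma_finite_measure.RN_deriv_unique[OF sigma_finite_lborel]) simp_all
  then have RN: "AE y in lborel. enn2real (RN_deriv lborel ?\<nu> y) = g y"
    by eventually_elim (metis enn2real_ennreal g)
  have pos: "(\<integral>\<^sup>+y\<in>Y. ennreal (f (enn2real (RN_deriv lborel ?\<nu> y))) \<partial>lborel) =
      (\<integral>\<^sup>+y. ennreal (?u y) \<partial>lborel)"
    by (rule nn_integral_cong_AE) (use RN in eventually_elim, simp add: indicator_def)
  have neg: "(\<integral>\<^sup>+y\<in>Y. ennreal (- f (enn2real (RN_deriv lborel ?\<nu> y))) \<partial>lborel) =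
      (\<integral>\<^sup>+y. ennreal (- ?u y) \<partial>lborel)"
    by (rule nn_integral_cong_AE) (use RN in eventually_elim, simp add: indicator_def)
  have u: "integrable lborel ?u" using int by (simp add: set_integrable_def)
  from u have fin: "(\<integral>\<^sup>+y. ennreal (?u y) \<partial>lborel) \<noteq> \<infinity>" "(\<integral>\<^sup>+y. ennreal (- ?u y) \<partial>lborel) \<noteq> \<infinity>"
    unfolding real_integrable_def by blast+
  have ereal: "enn2ereal x = ereal (enn2real x)" if "x \<noteq> \<infinity>" for x
    using that by (metis enn2ereal_ennreal enn2real_nonneg ennreal_enn2real infinity_ennreal_def less_top)
  have "internal_energy Y f ?\<nu> = ereal (integral\<^sup>L lborel ?u)"
    unfolding internal_energy_def pos neg real_lebesgue_integral_def[OF u]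
    using \<open>absolutely_continuous lborel ?\<nu>\<close> fin by (simp add: ereal)
  then show ?thesis by (simp add: set_lebesgue_integral_def)
qed

locale congested_transport = congestion f for f :: "real \<Rightarrow> real" +
  fixes X :: "'a::euclidean_space set" and b :: real
    and c :: "'a \<Rightarrow> real \<Rightarrow> real" and \<mu> :: "'a measure"
  assumes X: "bounded X" "open X" and b: "b > 0"
    and C2: "C2_closure (X \<times> {0<..<b}) (\<lambda>(x, y). c x y)"
    and \<mu>: "\<mu> \<in> borel_probs X"
begin

abbreviation "Y \<equiv> {0<..<b}"
abbreviation "L \<equiv> M_c X Y c"

lemma cost_continuous: "continuous_on (closure X \<times> closure Y) (\<lambda>p. c (fst p) (snd p))"
  using C2 by (simp add: C2_closure_def closure_Times case_prod_beta')

lemma cost_Lipschitz: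
  "x \<in> closure X \<Longrightarrow> y0 \<in> closure Y \<Longrightarrow> y1 \<in> closure Y \<Longrightarrow> \<bar>c x y0 - c x y1\<bar> \<le> L * \<bar>y0 - y1\<bar>"
  using C2 by (intro M_c_Lipschitz X) auto

lemma M_c_nonneg: "L \<ge> 0"
proof -
  have "X \<noteq> {}" using borel_probsD(3)[OF \<mu>] by auto
  then obtain x where x: "x \<in> X" by blast
  \<comment> \<open>Any two distinct points of \<open>Y\<close> would do: a Lipschitz bound between
    them forces a nonnegative constant.\<close>
  have "0 \<le> \<bar>c x (b / 3) - c x (b / 2)\<bar>" by simp
  also have "\<dots> \<le> L * \<bar>b / 3 - b / 2\<bar>"
    using x b closure_subset[of X] closure_subset[of Y] by (intro cost_Lipschitz) auto
  finally show ?thesis using b by (simp add: zero_le_mult_iff)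
qed

text \<open>The uniform density has finite energy, so the minimal energy is not infinite. This
  forces absolute continuity and, as \<open>f\<close> is bounded below, integrability of the energy
  density.\<close>

lemma minimizer_density:
  assumes min: "is_minimizer X Y c f \<mu> \<nu>"
  obtains g where "g \<in> borel_measurable borel" "\<And>y. g y \<ge> 0"
    "\<nu> = density lborel (\<lambda>y. ennreal (g y))" "set_integrable lborel Y (\<lambda>y. f (g y))"
proof -
  have \<nu>: "\<nu> \<in> borel_probs (closure Y)" using min by (simp add: is_minimizer_def)
  interpret \<nu>: prob_space \<nu> using borel_probsD(1)[OF \<nu>] .
  have cost_fin: "\<bar>transport_cost X Y c \<mu> \<eta>\<bar> \<noteq> \<infinity>" if "\<eta> \<in> borel_probs (closure Y)" for \<eta>
    using that by (intro transport_cost_finite X cost_continuous \<mu>) auto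
  define u where "u y = (1 / b) * indicator Y y" for y :: real
  let ?\<eta> = "density lborel (\<lambda>y. ennreal (u y))"
  have u: "u \<in> borel_measurable borel" "\<And>y. u y \<ge> 0" unfolding u_def using b by auto
  have "emeasure ?\<eta> E = 1" if "Y \<subseteq> E" "E \<in> sets borel" for E
  proof -
    have "emeasure ?\<eta> E = (\<integral>\<^sup>+y. ennreal (1 / b) * indicator Y y \<partial>lborel)"
      using that u by (subst emeasure_density) (auto intro!: nn_integral_cong simp: u_def indicator_def)
    then show ?thesis
      using b by (simp add: nn_integral_cmult_indicator flip: ennreal_mult)
  qed
  then have \<eta>: "?\<eta> \<in> borel_probs (closure Y)"
    using closure_subset[of Y] by (auto simp: borel_probs_def intro!: prob_spaceI)
  have "set_integrable lborel Y (\<lambda>y. f (1 / b))"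
    unfolding set_integrable_def using b by (intro integrable_scaleR_left integrable_real_indicator) auto
  then have "set_integrable lborel Y (\<lambda>y. f (u y))"
    by (rule iffD1[OF set_integrable_cong, rotated -1]) (auto simp: u_def)
  then obtain r where r: "internal_energy Y f ?\<eta> = ereal r"
    using internal_energy_density[of u Y f] u by auto
  have "transport_cost X Y c \<mu> \<nu> + internal_energy Y f \<nu> \<le> transport_cost X Y c \<mu> ?\<eta> + ereal r"
    using min \<eta> unfolding is_minimizer_def r[symmetric] by blast
  then have E: "internal_energy Y f \<nu> \<noteq> \<infinity>"
    using cost_fin[OF \<nu>] cost_fin[OF \<eta>] by auto
  then have ac: "absolutely_continuous lborel \<nu>"
    by (auto simp: internal_energy_def split: if_splits)
  have sets: "sets \<nu> = sets lborel" using borel_probsD(2)[OF \<nu>] by simp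
  define g where "g y = enn2real (RN_deriv lborel \<nu> y)" for y
  have [measurable]: "g \<in> borel_measurable borel" unfolding g_def by measurable
  have g: "g y \<ge> 0" for y unfolding g_def by simp
  \<comment> \<open>Off a null set \<open>RN_deriv\<close> is finite, so passing to its real-valued
    version leaves the measure unchanged.\<close>
  have "AE y in lborel. RN_deriv lborel \<nu> y \<noteq> \<infinity>"
    by (rule sigma_finite_measure.RN_deriv_finite[OF sigma_finite_lborel _ ac sets]) unfold_locales
  then have "AE y in lborel. RN_deriv lborel \<nu> y = ennreal (g y)"
    by eventually_elim (simp add: g_def less_top)
  then have "density lborel (RN_deriv lborel \<nu>) = density lborel (\<lambda>y. ennreal (g y))"
    by (intro density_cong) measurable
  then have \<nu>_eq: "\<nu> = density lborel (\<lambda>y. ennreal (g y))"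
    using sigma_finite_measure.density_RN_deriv[OF sigma_finite_lborel ac sets] by simp
  obtain m where m: "\<And>s. s \<ge> 0 \<Longrightarrow> m \<le> f s" using bounded_below by blast
  have [measurable]: "(\<lambda>y. f (g y)) \<in> borel_measurable borel"
    by (rule borel_measurable_comp) (use g in auto)
  have neg: "(\<integral>\<^sup>+y\<in>Y. ennreal (- f (g y)) \<partial>lborel) < \<infinity>"
  proof -
    have "(\<integral>\<^sup>+y\<in>Y. ennreal (- f (g y)) \<partial>lborel) \<le> (\<integral>\<^sup>+y. ennreal \<bar>m\<bar> * indicator Y y \<partial>lborel)"
    proof (intro nn_integral_mono mult_right_mono ennreal_leI)
      fix y show "- f (g y) \<le> \<bar>m\<bar>" using m[OF g[of y]] by linarith
    qed simp
    also have "\<dots> < \<infinity>" using b by (simp add: nn_integral_cmult_indicator ennreal_mult_less_top)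
    finally show ?thesis .
  qed
  have "(\<integral>\<^sup>+y\<in>Y. ennreal (f (g y)) \<partial>lborel) \<noteq> \<infinity>"
  proof
    assume "(\<integral>\<^sup>+y\<in>Y. ennreal (f (g y)) \<partial>lborel) = \<infinity>"
    then have "internal_energy Y f \<nu> = \<infinity>"
      using ac neg by (auto simp: internal_energy_def g_def[symmetric] ereal_minus_eq_PInfty_iff)
    with E show False ..
  qed
  moreover have "(\<integral>\<^sup>+y. ennreal (indicator Y y *\<^sub>R f (g y)) \<partial>lborel) = (\<integral>\<^sup>+y\<in>Y. ennreal (f (g y)) \<partial>lborel)"
    "(\<integral>\<^sup>+y. ennreal (- (indicator Y y *\<^sub>R f (g y))) \<partial>lborel) = (\<integral>\<^sup>+y\<in>Y. ennreal (- f (g y)) \<partial>lborel)"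
    by (auto intro!: nn_integral_cong simp: indicator_def)
  ultimately have "set_integrable lborel Y (\<lambda>y. f (g y))"
    using neg unfolding set_integrable_def real_integrable_def by simp
  with \<nu>_eq g show thesis by (intro that[of g]) auto
qed

section \<open>Optimality conditions for the density of a minimizer\<close>

context
  fixes g :: "real \<Rightarrow> real"
  assumes min: "is_minimizer X Y c f \<mu> (density lborel (\<lambda>y. ennreal (g y)))"
    and g_borel [measurable]: "g \<in> borel_measurable borel" and g_nonneg: "\<And>y. g y \<ge> 0"
    and energy: "set_integrable lborel Y (\<lambda>y. f (g y))"
begin

lemma density_probs: "density lborel (\<lambda>y. ennreal (g y)) \<in> borel_probs (closure Y)"
  using min by (simp add: is_minimizer_def)

lemma nn_integral_density_eq_1: "(\<integral>\<^sup>+y. ennreal (g y) \<partial>lborel) = 1"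
  using prob_space.emeasure_space_1[OF borel_probsD(1)[OF density_probs]]
  by (simp add: emeasure_density)

lemma integrable_density: "integrable lborel g"
  and integral_density_eq_1: "integral\<^sup>L lborel g = 1"
  using nn_integral_density_eq_1 g_nonneg
  by (auto intro!: integrableI_nonneg simp: integral_eq_nn_integral)

lemma AE_density_closure: "AE y in lborel. g y > 0 \<longrightarrow> y \<in> closure Y"
proof -
  have "AE y in density lborel (\<lambda>y. ennreal (g y)). y \<in> closure Y"
    by (rule borel_probs_AE[OF density_probs]) simp
  then show ?thesis by (simp add: AE_density)
qed

lemma AE_density_support: "AE y in lborel. g y > 0 \<longrightarrow> y \<in> Y"
  using AE_density_closure AE_lborel_singleton[of 0] AE_lborel_singleton[of b]
  by eventually_elim (use b in \<open>auto simp: closure_greaterThanLessThan\<close>)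

lemma LINT_density: "(LINT y:Y|lborel. g y) = 1"
proof -
  have "(LINT y:Y|lborel. g y) = integral\<^sup>L lborel g"
    unfolding set_lebesgue_integral_def
  proof (rule integral_cong_AE)
    show "AE y in lborel. indicator Y y *\<^sub>R g y = g y"
      using AE_density_support
    proof eventually_elim
      case (elim y)
      then show ?case using g_nonneg[of y] by (cases "g y = 0") (auto simp: less_le)
    qed
  qed measurable
  then show ?thesis by (simp add: integral_density_eq_1)
qed

text \<open>Off \<open>{0<..}\<close> the values of \<open>deriv f\<close> are unconstrained; fixing
  them yields a Borel function.\<close>

definition f' :: "real \<Rightarrow> real" where "f' s = (if s > 0 then deriv f s else 0)"

lemma f'_borel [measurable]: "f' \<in> borel_measurable borel"
  unfolding f'_def[abs_def] by (rule borel_measurable_deriv)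

lemma f'_mono: "0 < s \<Longrightarrow> s \<le> r \<Longrightarrow> f' s \<le> f' r"
  using deriv_strict_mono[of s r] by (cases "s = r") (auto simp: f'_def)

text \<open>If \<open>A\<close> had positive measure, moving density \<open>\<epsilon>\<close> from
  \<open>A\<close> by \<open>t\<close> would lower the total: on \<open>A\<close> the drop in slope
  exceeds the transport cost, and convexity turns slopes into energy differences. A fixed
  \<open>\<epsilon>\<close> in place of a limit and the bounds by \<open>2 * \<epsilon>\<close> and
  \<open>N\<close> keep the slopes integrable.\<close>

lemma null_improving_shift:
  fixes t \<epsilon> N :: real
  assumes \<epsilon>: "\<epsilon> > 0"
  defines "A \<equiv> {y. y \<in> Y \<and> y + t \<in> Y \<and> 2 * \<epsilon> < g y \<and> g y < N \<and> g (y + t) < N \<and>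
    f' (g (y + t) + \<epsilon>) + L * \<bar>t\<bar> < f' (g y - \<epsilon>)}"
  shows "AE y in lborel. y \<notin> A"
proof -
  have A[measurable]: "A \<in> sets borel" unfolding A_def by measurable
  have AY: "A \<subseteq> Y" by (auto simp: A_def)
  have "emeasure lborel A < \<infinity>"
    using bounded_subset[OF _ AY] by (intro emeasure_bounded_finite) simp
  then have int_A: "integrable lborel (indicator A :: real \<Rightarrow> real)"
    by (intro integrable_real_indicator) auto
  define h where "h y = g y - \<epsilon> * indicator A y + \<epsilon> * indicator A (y - t)" for y
  have h_borel[measurable]: "h \<in> borel_measurable borel" unfolding h_def by measurable
  have h: "h y \<ge> 0" for y
    using g_nonneg[of y] \<epsilon> by (auto simp: h_def indicator_def A_def)
  define U where "U y = indicator A y * f' (g y - \<epsilon>)" for y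
  define V where "V y = indicator A y * f' (g (y + t) + \<epsilon>)" for y
  have [measurable]: "U \<in> borel_measurable borel" "V \<in> borel_measurable borel"
    unfolding U_def V_def by measurable
  \<comment> \<open>On \<open>A\<close> the arguments of \<open>f'\<close> stay between
    \<open>\<epsilon>\<close> and \<open>N + \<epsilon>\<close>, so by monotonicity the values at
    these ends bound the slopes.\<close>
  define C where "C = \<bar>f' \<epsilon>\<bar> + \<bar>f' (N + \<epsilon>)\<bar>"
  have f'_bound: "\<bar>f' s\<bar> \<le> C" if "\<epsilon> \<le> s" "s \<le> N + \<epsilon>" for s
    using f'_mono[of \<epsilon> s] f'_mono[of s "N + \<epsilon>"] that \<epsilon> unfolding C_def by linarith
  have U_bound: "\<bar>U y\<bar> \<le> C * indicator A y" for y
  proof (cases "y \<in> A")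
    case True
    then have "\<bar>f' (g y - \<epsilon>)\<bar> \<le> C" by (intro f'_bound) (use \<epsilon> in \<open>auto simp: A_def\<close>)
    with True show ?thesis by (simp add: U_def)
  qed (simp add: U_def)
  have V_bound: "\<bar>V y\<bar> \<le> C * indicator A y" for y
  proof (cases "y \<in> A")
    case True
    then have "\<bar>f' (g (y + t) + \<epsilon>)\<bar> \<le> C"
      by (intro f'_bound) (use g_nonneg[of "y + t"] in \<open>auto simp: A_def\<close>)
    with True show ?thesis by (simp add: V_def)
  qed (simp add: V_def)
  have int_bound: "integrable lborel W"
    if "W \<in> borel_measurable lborel" "\<And>y. \<bar>W y\<bar> \<le> C * indicator A y" for W
  proof (rule Bochner_Integration.integrable_bound[OF integrable_mult_right[OF int_A, of C] that(1)])
    show "AE y in lborel. norm (W y) \<le> norm (C * indicator A y)"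
      using order.trans[OF that(2) abs_ge_self] by (intro AE_I2) simp
  qed
  have int_U: "integrable lborel U" by (rule int_bound[OF _ U_bound]) measurable
  have int_V: "integrable lborel V" by (rule int_bound[OF _ V_bound]) measurable
  have int_V': "integrable lborel (\<lambda>y. V (y - t))"
    and V': "integral\<^sup>L lborel (\<lambda>y. V (y - t)) = integral\<^sup>L lborel V"
    using lborel_integrable_real_affine[OF int_V, of 1 "- t"]
      lborel_integral_real_affine[of 1 V "- t"] by auto
  have int_A': "integrable lborel (\<lambda>y. indicator A (y - t) :: real)"
    and A': "integral\<^sup>L lborel (\<lambda>y. indicator A (y - t) :: real) = measure lborel A"
    using lborel_integrable_real_affine[OF int_A, of 1 "- t"]
      lborel_integral_real_affine[of 1 "indicator A :: real \<Rightarrow> real" "- t"] by auto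

  \<comment> \<open>Tangents at the perturbed values bound the change of \<open>f\<close>. Where
    \<open>y\<close> both loses and receives mass, \<open>h y = g y\<close>, and monotonicity of
    \<open>f'\<close> makes the two correction terms add up to something nonnegative.\<close>
  have f_h: "f (h y) \<le> f (g y) - \<epsilon> * U y + \<epsilon> * V (y - t)" for y
  proof -
    have "f (g y - \<epsilon>) - f (g y) \<le> - \<epsilon> * f' (g y - \<epsilon>)" if "y \<in> A"
      using that tangent[of "g y" "g y - \<epsilon>"] g_nonneg[of y] \<epsilon> by (auto simp: A_def f'_def mult.commute)
    moreover have "f (g y + \<epsilon>) - f (g y) \<le> \<epsilon> * f' (g y + \<epsilon>)"
      using tangent[of "g y" "g y + \<epsilon>"] g_nonneg[of y] \<epsilon> by (auto simp: f'_def mult.commute)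
    moreover have "\<epsilon> * f' (g y - \<epsilon>) \<le> \<epsilon> * f' (g y + \<epsilon>)" if "y \<in> A"
      using that \<epsilon> by (intro mult_left_mono f'_mono) (auto simp: A_def)
    ultimately show ?thesis
      by (auto simp: h_def U_def V_def indicator_def)
  qed

  obtain m where m: "\<And>s. s \<ge> 0 \<Longrightarrow> m \<le> f s" using bounded_below by blast
  let ?R = "\<lambda>y. indicator Y y * f (g y) - \<epsilon> * U y + \<epsilon> * V (y - t)"
  have energy': "integrable lborel (\<lambda>y. indicator Y y * f (g y))"
    using energy by (simp add: set_integrable_def)
  have int_R: "integrable lborel ?R"
    using energy' int_U int_V' by (intro Bochner_Integration.integrable_add
        Bochner_Integration.integrable_diff integrable_mult_right)
  have le_R: "indicator Y y * f (h y) \<le> ?R y" for y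
    using f_h[of y] AY by (cases "y \<in> Y") (auto simp: U_def V_def indicator_def A_def)
  have f_h_borel: "(\<lambda>y. f (h y)) \<in> borel_measurable borel"
    by (rule borel_measurable_comp) (use h in auto)
  have int_m: "integrable lborel (\<lambda>y. \<bar>m\<bar> * indicator Y y)" using b by simp
  have int_h: "integrable lborel (\<lambda>y. indicator Y y * f (h y))"
  proof (rule Bochner_Integration.integrable_bound)
    show "integrable lborel (\<lambda>y. \<bar>m\<bar> * indicator Y y + \<bar>?R y\<bar>)"
      by (rule Bochner_Integration.integrable_add[OF int_m integrable_abs[OF int_R]])
    show "AE y in lborel. norm (indicator Y y * f (h y)) \<le> norm (\<bar>m\<bar> * indicator Y y + \<bar>?R y\<bar>)"
    proof (rule AE_I2)
      fix y
      have "- (\<bar>m\<bar> * indicator Y y) \<le> indicator Y y * f (h y)"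
        using m[OF h[of y]] by (auto simp: indicator_def)
      moreover have "0 \<le> \<bar>m\<bar> * indicator Y y" by simp
      ultimately show "norm (indicator Y y * f (h y)) \<le> norm (\<bar>m\<bar> * indicator Y y + \<bar>?R y\<bar>)"
        using le_R[of y] unfolding real_norm_def by linarith
    qed
    show "(\<lambda>y. indicator Y y * f (h y)) \<in> borel_measurable lborel"
      using f_h_borel by measurable
  qed

  let ?\<nu> = "density lborel (\<lambda>y. ennreal (g y))"
  let ?\<nu>' = "density lborel (\<lambda>y. ennreal (h y))"
  have "integrable lborel h"
    unfolding h_def using integrable_density int_A int_A'
    by (intro Bochner_Integration.integrable_add Bochner_Integration.integrable_diff integrable_mult_right)
  moreover have "integral\<^sup>L lborel h = 1"
    unfolding h_def using integrable_density int_A int_A' A' integral_density_eq_1 by simp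
  ultimately have h1: "(\<integral>\<^sup>+y. ennreal (h y) \<partial>lborel) = 1"
    using h by (simp add: nn_integral_eq_integral)
  interpret \<nu>': prob_space ?\<nu>'
    by (rule prob_spaceI) (simp add: emeasure_density h1)
  have "AE y in lborel. ennreal (h y) > 0 \<longrightarrow> y \<in> closure Y"
    using AE_density_closure
  proof eventually_elim
    case (elim y)
    show ?case
    proof (cases "y \<in> Y")
      case False
      then have "h y = g y" using AY by (auto simp: h_def indicator_def A_def)
      with elim show ?thesis by simp
    qed (use closure_subset[of Y] in auto)
  qed
  then have "AE y in ?\<nu>'. y \<in> closure Y" by (subst AE_density) simp_all
  then have "emeasure ?\<nu>' (closure Y) = 1"
    by (intro \<nu>'.emeasure_eq_1_AE) auto
  then have \<nu>': "?\<nu>' \<in> borel_probs (closure Y)"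
    by (simp add: borel_probs_def \<nu>'.prob_space_axioms)

  have "transport_cost X Y c \<mu> ?\<nu>' \<le> transport_cost X Y c \<mu> ?\<nu> + ereal (L * \<bar>t\<bar> * (\<epsilon> * measure lborel A))"
    unfolding h_def
  proof (rule transport_cost_shift)
    fix x y assume "x \<in> closure X" "y \<in> A"
    then have "\<bar>c x (y + t) - c x y\<bar> \<le> L * \<bar>y + t - y\<bar>"
      using closure_subset[of Y] by (intro cost_Lipschitz) (auto simp: A_def)
    then show "c x (y + t) \<le> c x y + L * \<bar>t\<bar>" by simp
  qed (use X cost_continuous \<mu> g_nonneg \<epsilon> density_probs M_c_nonneg in \<open>auto simp: A_def\<close>)
  moreover have "transport_cost X Y c \<mu> ?\<nu> + internal_energy Y f ?\<nu> \<le>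
      transport_cost X Y c \<mu> ?\<nu>' + internal_energy Y f ?\<nu>'"
    using min \<nu>' by (simp add: is_minimizer_def)
  moreover have "internal_energy Y f ?\<nu> = ereal (\<integral>y. indicator Y y * f (g y) \<partial>lborel)"
    using internal_energy_density[of g Y f] energy g_nonneg by (simp add: set_lebesgue_integral_def)
  moreover have "internal_energy Y f ?\<nu>' = ereal (\<integral>y. indicator Y y * f (h y) \<partial>lborel)"
    using internal_energy_density[of h Y f] h int_h
    by (simp add: set_lebesgue_integral_def set_integrable_def)
  moreover have "\<bar>transport_cost X Y c \<mu> ?\<nu>\<bar> \<noteq> \<infinity>" "\<bar>transport_cost X Y c \<mu> ?\<nu>'\<bar> \<noteq> \<infinity>"
    by (intro transport_cost_finite X cost_continuous \<mu> density_probs \<nu>'; simp)+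
  ultimately have "(\<integral>y. indicator Y y * f (g y) \<partial>lborel) \<le>
      (\<integral>y. indicator Y y * f (h y) \<partial>lborel) + L * \<bar>t\<bar> * (\<epsilon> * measure lborel A)"
    by (cases "transport_cost X Y c \<mu> ?\<nu>"; cases "transport_cost X Y c \<mu> ?\<nu>'") auto
  also have "(\<integral>y. indicator Y y * f (h y) \<partial>lborel) \<le> integral\<^sup>L lborel ?R"
    by (intro integral_mono int_h int_R le_R)
  also have "\<dots> = (\<integral>y. indicator Y y * f (g y) \<partial>lborel) - \<epsilon> * integral\<^sup>L lborel U + \<epsilon> * integral\<^sup>L lborel V"
    using energy' int_U int_V' V' by simp
  finally have "\<epsilon> * (integral\<^sup>L lborel U - integral\<^sup>L lborel V - L * \<bar>t\<bar> * measure lborel A) \<le> 0"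
    by (simp add: algebra_simps)
  then have le: "integral\<^sup>L lborel U - integral\<^sup>L lborel V - L * \<bar>t\<bar> * measure lborel A \<le> 0"
    using \<epsilon> by (simp add: mult_le_0_iff)

  \<comment> \<open>\<open>?D\<close> is positive on \<open>A\<close> and zero elsewhere, yet by
    minimality its integral is not positive; hence \<open>A\<close> is null.\<close>
  let ?D = "\<lambda>y. U y - V y - L * \<bar>t\<bar> * indicator A y"
  have int_D: "integrable lborel ?D" using int_U int_V int_A by simp
  have D_pos: "?D y > 0" if "y \<in> A" for y
    using that by (auto simp: U_def V_def A_def)
  have D: "?D y \<ge> 0" for y
    using D_pos[of y] by (cases "y \<in> A") (auto simp: U_def V_def)
  have "integral\<^sup>L lborel ?D = 0"
    using le int_U int_V int_A D Bochner_Integration.integral_nonneg[of lborel ?D] by (intro antisym) simp_all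
  then have "AE y in lborel. ?D y = 0"
    using integral_nonneg_eq_0_iff_AE[OF int_D] D by simp
  then show ?thesis
    by eventually_elim (use D_pos in force)
qed

text \<open>A point violating the bound lies in one of countably many null sets from
  \<open>null_improving_shift\<close>, with \<open>\<epsilon>\<close> the reciprocal of a positive
  integer and \<open>N\<close> a natural number.\<close>

lemma AE_shift_bound:
  "AE y in lborel. y \<in> Y \<and> y + t \<in> Y \<and> g y > 0 \<longrightarrow>
    g (y + t) > 0 \<and> f' (g y) \<le> f' (g (y + t)) + L * \<bar>t\<bar>"
proof -
  let ?A = "\<lambda>\<epsilon> N. {y. y \<in> Y \<and> y + t \<in> Y \<and> 2 * \<epsilon> < g y \<and> g y < N \<and> g (y + t) < N \<and>
    f' (g (y + t) + \<epsilon>) + L * \<bar>t\<bar> < f' (g y - \<epsilon>)}"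
  have "AE y in lborel. \<forall>n N. y \<notin> ?A (inverse (real (Suc n))) (real N)"
    unfolding AE_all_countable by (intro allI null_improving_shift) simp
  then show ?thesis
  proof eventually_elim
    case (elim y)
    show ?case
    proof (rule ccontr)
      assume "\<not> ?thesis"
      then have y: "y \<in> Y" "y + t \<in> Y" "g y > 0"
        and bad: "g (y + t) > 0 \<Longrightarrow> f' (g y) > f' (g (y + t)) + L * \<bar>t\<bar>"
        by auto
      let ?r = "g (y + t)"
      \<comment> \<open>A level \<open>w\<close> is placed strictly between the two slopes. If
        \<open>?r = 0\<close>, any sufficiently low level works, because \<open>deriv_inv f\<close>
        is positive everywhere; this is how positivity of \<open>g\<close> propagates.\<close>
      have "\<exists>w. ?r < deriv_inv f w \<and> w + L * \<bar>t\<bar> < f' (g y)"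
      proof (cases "?r = 0")
        case True
        then show ?thesis
          by (intro exI[of _ "f' (g y) - L * \<bar>t\<bar> - 1"]) (simp add: deriv_inv_pos)
      next
        case False
        with g_nonneg[of "y + t"] have r: "?r > 0" by simp
        obtain w where w: "f' ?r < w" "w < f' (g y) - L * \<bar>t\<bar>"
          using dense[of "f' ?r" "f' (g y) - L * \<bar>t\<bar>"] bad[OF r] by auto
        have "?r = deriv_inv f (f' ?r)" using r by (simp add: f'_def deriv_inv_deriv)
        also have "\<dots> < deriv_inv f w" using w by (simp add: deriv_inv_less_iff)
        finally show ?thesis using w by (intro exI[of _ w]) auto
      qed
      then obtain w where w: "?r < deriv_inv f w" "w + L * \<bar>t\<bar> < f' (g y)" by blast
      \<comment> \<open>\<open>p\<close> and \<open>q\<close> translate the levels back to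
        densities; the gaps \<open>?r < p\<close> and \<open>q < g y\<close> leave room for
        \<open>\<epsilon>\<close>.\<close>
      define p where "p = deriv_inv f w"
      define q where "q = deriv_inv f (w + L * \<bar>t\<bar>)"
      have p: "p > 0" "f' p = w" "?r < p"
        using w deriv_inv_pos by (auto simp: p_def f'_def deriv_deriv_inv)
      have q: "q > 0" "f' q = w + L * \<bar>t\<bar>"
        using deriv_inv_pos by (auto simp: q_def f'_def deriv_deriv_inv)
      have "q < g y"
        using w(2) y(3) q f'_mono[of "g y" q] by (auto simp flip: not_le)
      obtain n where n: "inverse (real (Suc n)) < Min {p - ?r, g y - q, g y / 2}"
        using reals_Archimedean[of "Min {p - ?r, g y - q, g y / 2}"] p \<open>q < g y\<close> y by auto
      define \<epsilon> where "\<epsilon> = inverse (real (Suc n))"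
      have \<epsilon>: "\<epsilon> > 0" "?r + \<epsilon> < p" "q < g y - \<epsilon>" "2 * \<epsilon> < g y"
        using n unfolding \<epsilon>_def by auto
      obtain N where N: "max (g y) ?r < real N" using reals_Archimedean2 by blast
      have "f' (?r + \<epsilon>) < w"
        using \<epsilon> p g_nonneg[of "y + t"] deriv_strict_mono[of "?r + \<epsilon>" p] by (auto simp: f'_def)
      moreover have "w + L * \<bar>t\<bar> < f' (g y - \<epsilon>)"
        using \<epsilon> q deriv_strict_mono[of q "g y - \<epsilon>"] by (auto simp: f'_def)
      ultimately have "y \<in> ?A \<epsilon> (real N)"
        using y \<epsilon> N by auto
      with elim show False unfolding \<epsilon>_def by blast
    qed
  qed
qed

text \<open>The exceptional null set of \<open>AE_shift_bound\<close> depends on \<open>t\<close>.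
  Fubini exchanges the quantifiers over \<open>t\<close> and \<open>z\<close>, and then
  \<open>t = z - y\<close> is substituted.\<close>

lemma AE_AE_bound:
  "AE z in lborel. AE y in lborel. y \<in> Y \<and> z \<in> Y \<and> g y > 0 \<longrightarrow>
    g z > 0 \<and> f' (g y) \<le> f' (g z) + L * \<bar>z - y\<bar>"
proof -
  define Q where "Q y z \<longleftrightarrow> (y \<in> Y \<and> z \<in> Y \<and> g y > 0 \<longrightarrow>
    g z > 0 \<and> f' (g y) \<le> f' (g z) + L * \<bar>z - y\<bar>)" for y z
  have [measurable]: "Measurable.pred borel (\<lambda>y. Q y (y + t))" "Measurable.pred borel (\<lambda>t. Q (z - t) z)" for t z
    unfolding Q_def by measurable
  have Q: "{p \<in> space (lborel \<Otimes>\<^sub>M lborel). Q (snd p - fst p) (snd p)} \<in> sets (lborel \<Otimes>\<^sub>M lborel)"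
    unfolding Q_def by measurable
  have "AE z in lborel. Q (z - t) z" for t
  proof -
    have "AE y in lborel. Q y (y + t)" using AE_shift_bound[of t] by (simp add: Q_def)
    from AE_borel_affine[OF _ _ this, of 1 "- t"] show ?thesis by simp
  qed
  then have "AE t in lborel. AE z in lborel. Q (z - t) z" by simp
  then have "AE z in lborel. AE t in lborel. Q (z - t) z"
    unfolding lborel_pair.AE_commute[OF Q] .
  then have "AE z in lborel. AE y in lborel. Q y z"
  proof eventually_elim
    case (elim z)
    from AE_borel_affine[OF _ _ elim, of "- 1" z] show ?case by simp
  qed
  then show ?thesis unfolding Q_def .
qed

lemma AE_density_lower_bound:
  "AE z in lborel. z \<in> Y \<longrightarrow> deriv_inv f (K_inv Y f (\<lambda>y. - L * \<bar>y\<bar>) 1 - L * z) \<le> g z"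
  using AE_AE_bound
proof eventually_elim
  case (elim z)
  show ?case
  proof
    assume z: "z \<in> Y"
    have int_g: "set_integrable lborel Y g"
      unfolding set_integrable_def by (rule integrable_mult_indicator[OF _ integrable_density]) simp
    \<comment> \<open>If \<open>g z\<close> were zero, the bound at \<open>z\<close> would force
      \<open>g\<close> to vanish almost everywhere on \<open>Y\<close>, against total mass
      one.\<close>
    have pos: "g z > 0"
    proof (rule ccontr)
      assume "\<not> g z > 0"
      then have "AE y in lborel. indicator Y y *\<^sub>R g y = 0"
        using elim z g_nonneg
        by (auto elim!: eventually_mono simp: indicator_def not_less intro: antisym)
      then have "(LINT y:Y|lborel. g y) = 0"
        unfolding set_lebesgue_integral_def by (intro integral_eq_zero_AE)
      then show False using LINT_density by simp
    qed
    define w where "w = f' (g z) + L * z"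
    have "1 = (LINT y:Y|lborel. g y)" using LINT_density by simp
    also have "\<dots> \<le> (LINT y:Y|lborel. deriv_inv f (w - - L * \<bar>y\<bar>))"
    proof (rule set_integral_mono_AE[OF int_g set_integrable_deriv_inv[OF b M_c_nonneg]])
      show "AE y\<in>Y in lborel. g y \<le> deriv_inv f (w - - L * \<bar>y\<bar>)"
        using elim
      proof eventually_elim
        case (elim y)
        show ?case
        proof
          assume y: "y \<in> Y"
          show "g y \<le> deriv_inv f (w - - L * \<bar>y\<bar>)"
          proof (cases "g y > 0")
            case True
            \<comment> \<open>This cruder distance separates the variables: \<open>z\<close> goes
              into \<open>w\<close>, and \<open>y\<close> into the function
              \<open>- L * \<bar>y\<bar>\<close> that defines the level
              \<open>K_inv\<close>.\<close>
            have "L * \<bar>z - y\<bar> \<le> L * (z + y)"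
              using y z M_c_nonneg by (intro mult_left_mono) auto
            with True elim y z have "f' (g y) \<le> w - - L * \<bar>y\<bar>"
              by (simp add: w_def algebra_simps)
            then have "deriv_inv f (f' (g y)) \<le> deriv_inv f (w - - L * \<bar>y\<bar>)"
              by (simp only: deriv_inv_le_iff)
            with True show ?thesis by (simp add: f'_def deriv_inv_deriv)
          next
            case False
            then show ?thesis using deriv_inv_pos[of "w - - L * \<bar>y\<bar>"] by linarith
          qed
        qed
      qed
    qed
    finally have "K_inv Y f (\<lambda>y. - L * \<bar>y\<bar>) 1 \<le> w"
      by (rule K_inv_le[OF b M_c_nonneg])
    then have "deriv_inv f (K_inv Y f (\<lambda>y. - L * \<bar>y\<bar>) 1 - L * z) \<le> deriv_inv f (f' (g z))"
      by (simp add: deriv_inv_le_iff w_def)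
    also have "\<dots> = g z" using pos by (simp add: f'_def deriv_inv_deriv)
    finally show "deriv_inv f (K_inv Y f (\<lambda>y. - L * \<bar>y\<bar>) 1 - L * z) \<le> g z" .
  qed
qed

end

text \<open>The pointwise lower bound does not increase along \<open>Y\<close>, as \<open>L\<close>
  is nonnegative, so its value at \<open>y1\<close> serves on the whole interval.\<close>

lemma minimizer_measure_lower_bound:
  assumes min: "is_minimizer X Y c f \<mu> \<nu>" and y: "0 < y0" "y0 < y1" "y1 < b"
  shows "(y1 - y0) * deriv_inv f (K_inv Y f (\<lambda>y. - L * \<bar>y\<bar>) 1 - L * y1) \<le> measure \<nu> {y0<..y1}"
proof -
  let ?G = "\<lambda>y. deriv_inv f (K_inv Y f (\<lambda>y. - L * \<bar>y\<bar>) 1 - L * y)"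
  obtain g where g: "g \<in> borel_measurable borel" "\<And>y. g y \<ge> 0"
    and \<nu>: "\<nu> = density lborel (\<lambda>y. ennreal (g y))" and e: "set_integrable lborel Y (\<lambda>y. f (g y))"
    using minimizer_density[OF min] by blast
  note [measurable] = g(1)
  interpret prob_space \<nu> using min borel_probsD(1) by (auto simp: is_minimizer_def)
  have "ennreal ((y1 - y0) * ?G y1) = ennreal (?G y1) * emeasure lborel {y0<..y1}"
    using y less_imp_le[OF deriv_inv_pos] by (simp add: mult.commute flip: ennreal_mult)
  also have "\<dots> = (\<integral>\<^sup>+y. ennreal (?G y1) * indicator {y0<..y1} y \<partial>lborel)"
    by (rule nn_integral_cmult_indicator[symmetric]) simp
  also have "\<dots> \<le> (\<integral>\<^sup>+y. ennreal (g y) * indicator {y0<..y1} y \<partial>lborel)"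
  proof (rule nn_integral_mono_AE)
    show "AE y in lborel. ennreal (?G y1) * indicator {y0<..y1} y \<le> ennreal (g y) * indicator {y0<..y1} y"
      using AE_density_lower_bound[OF min[unfolded \<nu>] g e]
    proof eventually_elim
      case (elim z)
      show ?case
      proof (cases "z \<in> {y0<..y1}")
        case True
        then have "L * z \<le> L * y1" using M_c_nonneg by (intro mult_left_mono) auto
        then have "?G y1 \<le> ?G z" by (simp add: deriv_inv_le_iff)
        with elim True y have "?G y1 \<le> g z" by auto
        then show ?thesis using True by (simp add: ennreal_leI)
      qed simp
    qed
  qed
  also have "\<dots> = emeasure \<nu> {y0<..y1}"
    unfolding \<nu> by (subst emeasure_density) simp_all
  finally show ?thesis by (simp add: emeasure_eq_measure)
qed

end

section \<open>Nestedness from the comparison of mass levels\<close>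

theorem theorem11:
  fixes X :: "(real ^ 'm) set"
    and Y :: "real set"
    and ybar :: real
    and c :: "real ^ 'm \<Rightarrow> real \<Rightarrow> real"
    and \<mu> :: "(real ^ 'm) measure"
    and \<nu> :: "real measure"
    and f :: "real \<Rightarrow> real"
    and k :: "real \<Rightarrow> real"
  assumes dim: "CARD('m) > 1"
    and X: "bounded X" "open X"
    and Y: "ybar > 0" "Y = {0<..<ybar}"
    and c: "C2_closure (X \<times> Y) (\<lambda>(x, y). c x y)" "twisted X Y c" "nondegenerate X Y c"
    and \<mu>: "\<mu> \<in> borel_probs X" "absolutely_continuous lborel \<mu>"
    and f_C1: "f differentiable_on {0<..}" "continuous_on {0<..} (deriv f)"
    and f_convex: "strictly_convex_on {0..} f"
    and f_superlinear: "filterlim (\<lambda>s. f s / s) at_top at_top"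
    and f_deriv_0: "filterlim (deriv f) at_bot (at_right 0)"
    and minimizer: "is_minimizer X Y c f \<mu> \<nu>"
    and k: "mass_splitting_level X Y c \<mu> \<nu> k"
    and sup_neg: "\<And>y0. y0 \<in> Y \<Longrightarrow>
      (SUP (y1, y) \<in> {(y1, y). y1 \<in> Y \<and> y1 > y0 \<and> y0 \<le> y \<and> y \<le> y1}.
         ereal (D_min X c \<mu> y0 y1 (k y0) / (y1 - y0)
           - deriv_inv f (K_inv Y f (\<lambda>y. - M_c X Y c * \<bar>y\<bar>) 1 - M_c X Y c * y))) < 0"
  shows "nested X Y c \<nu> k"
proof -
  interpret T: congested_transport f X ybar c \<mu>
    using X Y c \<mu> f_C1 f_convex f_superlinear f_deriv_0 by unfold_locales auto
  let ?G = "\<lambda>y. deriv_inv f (K_inv Y f (\<lambda>y. - M_c X Y c * \<bar>y\<bar>) 1 - M_c X Y c * y)"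
  have "\<nu> \<in> borel_probs (closure Y)" using minimizer by (simp add: is_minimizer_def)
  then interpret \<nu>: prob_space \<nu> by (rule borel_probsD)
  interpret \<mu>: prob_space \<mu> using \<mu>(1) by (rule borel_probsD)
  have sets: "sets \<mu> = sets borel" "sets \<nu> = sets borel"
    using borel_probsD(2)[OF \<mu>(1)] borel_probsD(2)[OF \<open>\<nu> \<in> _\<close>] by auto
  obtain D B where der: "\<And>x y. x \<in> X \<Longrightarrow> y \<in> Y \<Longrightarrow> (c x has_real_derivative D (x, y)) (at y)"
    and D: "continuous_on (X \<times> Y) D" and B: "\<And>p. p \<in> X \<times> Y \<Longrightarrow> \<bar>D p\<bar> \<le> B"
    by (rule C2_closure_has_partial_derivative[OF X(1) _ c(1)]) (use Y in auto)
  have X_ge: "X_ge X c y \<kappa> = {x \<in> X. \<kappa> \<le> D (x, y)}" if "y \<in> Y" for y \<kappa>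
    using DERIV_imp_deriv[OF der] that by (auto simp: X_ge_def)
  \<comment> \<open>The superlevel set is \<open>X\<close> minus a set that is open by continuity of
    \<open>D\<close>, hence Borel.\<close>
  have X_ge_sets: "X_ge X c y \<kappa> \<in> sets \<mu>" if "y \<in> Y" for y \<kappa>
  proof -
    have "continuous_on X (\<lambda>x. D (x, y))"
      using that by (intro continuous_on_compose2[OF D] continuous_intros) auto
    then have "open (X \<inter> (\<lambda>x. D (x, y)) -` {..<\<kappa>})"
      using X(2) by (intro continuous_open_preimage) auto
    moreover have "X_ge X c y \<kappa> = X - (X \<inter> (\<lambda>x. D (x, y)) -` {..<\<kappa>})"
      using that by (auto simp: X_ge)
    ultimately show ?thesis using X(2) sets by auto
  qed
  show ?thesis
    unfolding nested_def
  proof (intro ballI impI)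
    fix y0 y1 assume y: "y0 \<in> Y" "y1 \<in> Y" "y0 < y1"
    let ?X0 = "X_ge X c y0 (k y0)"
    \<comment> \<open>The supremum is tested at \<open>y = y1\<close>, where \<open>?G\<close> takes
      the value occurring in the bound for the measure of \<open>{y0<..y1}\<close>.\<close>
    have "ereal (D_min X c \<mu> y0 y1 (k y0) / (y1 - y0) - ?G y1) < 0"
      by (rule le_less_trans[OF _ sup_neg[OF y(1)]], rule SUP_upper2[of "(y1, y1)"]) (use y in auto)
    then have "D_min X c \<mu> y0 y1 (k y0) < (y1 - y0) * ?G y1"
      using y by (simp add: pos_divide_less_eq mult.commute)
    also have "\<dots> \<le> measure \<nu> {y0<..y1}"
      using T.minimizer_measure_lower_bound[of \<nu> y0 y1] minimizer y Y by simp
    finally have less: "D_min X c \<mu> y0 y1 (k y0) < measure \<nu> {y0<..y1}" .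
    show "?X0 \<subseteq> X_gt X c y1 (k y1)"
    proof (cases "?X0 = {}")
      case False
      then obtain x0 where x0: "x0 \<in> ?X0" by blast
      define r where "r = real_of_ereal (k_max X c y0 y1 (k y0))"
      \<comment> \<open>Each point of \<open>?X0\<close> bounds the admissible levels from above,
        and \<open>- B\<close> is admissible, so \<open>k_max\<close> is a real number
        \<open>r\<close>.\<close>
      have upper: "k_max X c y0 y1 (k y0) \<le> ereal (D (x, y1))" if "x \<in> ?X0" for x
        unfolding k_max_def using that y by (intro SUP_least) (auto simp: X_ge)
      have "ereal (- B) \<le> k_max X c y0 y1 (k y0)"
        unfolding k_max_def
      proof (intro SUP_upper CollectI subsetI)
        fix x assume "x \<in> ?X0"
        then show "x \<in> X_ge X c y1 (- B)"
          using B[of "(x, y1)"] y by (auto simp: X_ge)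
      qed
      with upper[OF x0] have r: "k_max X c y0 y1 (k y0) = ereal r"
        unfolding r_def by (cases "k_max X c y0 y1 (k y0)") auto
      \<comment> \<open>The supremum is itself admissible: it is at most \<open>D (x, y1)\<close>
        for each \<open>x\<close> in \<open>?X0\<close>.\<close>
      have sub: "?X0 \<subseteq> X_ge X c y1 r"
        using upper y unfolding r by (auto simp: X_ge)
      have "measure \<mu> (X_ge X c y1 r) = measure \<mu> ?X0 + D_min X c \<mu> y0 y1 (k y0)"
        using \<mu>.finite_measure_Diff[OF X_ge_sets X_ge_sets sub] y False by (simp add: D_min_def r_def)
      also have "\<dots> < measure \<nu> {..y0} + measure \<nu> {y0<..y1}"
        using less k y by (simp add: mass_splitting_level_def)
      also have "\<dots> = measure \<nu> ({..y0} \<union> {y0<..y1})"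
        by (rule \<nu>.finite_measure_Union[symmetric]) (auto simp: sets)
      also have "{..y0} \<union> {y0<..y1} = {..y1}" using y by auto
      also have "measure \<nu> {..y1} = measure \<mu> (X_ge X c y1 (k y1))"
        using k y by (simp add: mass_splitting_level_def)
      finally have *: "measure \<mu> (X_ge X c y1 r) < measure \<mu> (X_ge X c y1 (k y1))" .
      \<comment> \<open>Superlevel sets shrink as the level grows, so the larger mass belongs to the
        smaller level.\<close>
      have "k y1 < r"
      proof (rule ccontr)
        assume "\<not> k y1 < r"
        then have "X_ge X c y1 (k y1) \<subseteq> X_ge X c y1 r" by (auto simp: X_ge_def)
        from \<mu>.finite_measure_mono[OF this X_ge_sets[OF y(2)]] * show False by simp
      qed
      \<comment> \<open>The gap between \<open>k y1\<close> and \<open>r\<close> supplies the strict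
        inequality required by \<open>X_gt\<close>.\<close>
      with sub show ?thesis by (auto simp: X_gt_def X_eq_def X_ge_def)
    qed simp
  qed
qed

end
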